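(* Let $T$ be a tree with a rooted labeling. Then $S/I_T$ is a complete intersection if and only if $T$ is a path whose root is either a leaf or the neighbor of a leaf.
   Context: All graphs are finite and simple. Let $\mathbb{K}$ be a field, $n$ the number of vertices of $T$, $[n]=\{1,\ldots,n\}$ and $S=\mathbb{K}[x_1,\ldots,x_{n+1}]$. For $1\le i<j\le n$ put $g_{ij}=x_ix_{j+1}-x_jx_{i+1}$. For a graph $G$ with vertex set $[n]$, the Hankel edge ideal $I_G\subset S$ is the ideal generated by the $g_{ij}$ with $i<j$ and $\{i,j\}\in E(G)$. A rooted labeling of a tree $T$ with $n$ vertices is a labeling of its vertices by $1,\ldots,n$ obtained as follows (breadth-first). Choose any vertex as the root and give it the label $1$. Then process the labeled vertices $1,2,3,\ldots$ in increasing order of label; when vertex $i$ is processed, its not-yet-labeled neighbors receive the next consecutive smallest unused labels, in an arbitrary order among themselves. (Thus, if $1$ has $t_1$ neighbors they get labels $2,\ldots,t_1+1$; the $t_2$ unlabeled neighbors of $2$ get labels $t_1+2,\ldots,t_1+t_2+1$; and so on.) The vertices of $T$ are identified with their labels; the root is the vertex $1$. A leaf is a vertex of degree at most $1$ (degree $0$ occurs only when $n=1$). For a homogeneous ideal $I\subset S$, $\mu(I)$ is the cardinality of a minimal homogeneous generating set of $I$, and $S/I$ is a complete intersection if $\mu(I)=\operatorname{height} I$. *)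

theory Defs
  imports
    "HOL-Algebra.Ideal"
    "HOL-Library.Poly_Mapping"
    "HOL-Library.Extended_Nat"
    "Graph_Theory.Pair_Digraph"
    "Graph_Theory.Digraph_Component"
    "Graph_Theory.Vertex_Walk"
begin

section \<open>Trees, paths and rooted labelings\<close>

text \<open>
  Finite simple graphs are the library's \<open>pair_graph\<close>s: symmetric loop-free finite digraphs,
  the edge $\{u,v\}$ being the two arcs \<open>(u, v)\<close> and \<open>(v, u)\<close>.
  The library's \<open>forest\<close> and \<open>tree\<close> cannot be used for them, since they count \<open>u, v, u\<close>
  as a cycle.  An undirected cycle has at least three distinct vertices.
\<close>

definition undirected_acyclic :: "'v pair_pre_digraph \<Rightarrow> bool" where
  "undirected_acyclic G \<longleftrightarrow>
     \<not> (\<exists>p. vpath p (with_proj G) \<and> 3 \<le> length p \<and> (last p, hd p) \<in> parcs G)"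

definition undirected_tree :: "'v pair_pre_digraph \<Rightarrow> bool" where
  "undirected_tree G \<longleftrightarrow>
     pair_graph G \<and> Digraph_Component.connected (with_proj G) \<and> undirected_acyclic G"

definition path_graph :: "'v pair_pre_digraph \<Rightarrow> bool" where
  "path_graph G \<longleftrightarrow>
     (\<exists>p. p \<noteq> [] \<and> distinct p \<and> pverts G = set p \<and>
          parcs G = set (vwalk_arcs p) \<union> (set (vwalk_arcs p))\<inverse>)"

definition leaf :: "'v pair_pre_digraph \<Rightarrow> 'v \<Rightarrow> bool" where
  "leaf G v \<longleftrightarrow> v \<in> pverts G \<and> out_degree (with_proj G) v \<le> 1"

text \<open>
  \<open>bfs_state G i xs\<close>: after processing the labels $1,\ldots,i$, the labeled vertices are those
  in \<open>xs\<close>, and \<open>xs ! k\<close> carries the label $k+1$.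
\<close>

inductive bfs_state :: "'v pair_pre_digraph \<Rightarrow> nat \<Rightarrow> 'v list \<Rightarrow> bool" for G where
  root: "r \<in> pverts G \<Longrightarrow> bfs_state G 0 [r]"
| process: "bfs_state G (Suc i) (xs @ ys)"
    if "bfs_state G i xs" "i < length xs"
       "distinct ys" "set ys = {v. (xs ! i, v) \<in> parcs G \<and> v \<notin> set xs}"

definition rooted_labeling :: "'v pair_pre_digraph \<Rightarrow> ('v \<Rightarrow> nat) \<Rightarrow> bool" where
  "rooted_labeling G l \<longleftrightarrow>
     (\<exists>xs. bfs_state G (length xs) xs \<and> set xs = pverts G \<and>
           (\<forall>k < length xs. l (xs ! k) = k + 1))"

definition relabel :: "('v \<Rightarrow> 'w) \<Rightarrow> 'v pair_pre_digraph \<Rightarrow> 'w pair_pre_digraph" where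
  "relabel l G = \<lparr> pverts = l ` pverts G, parcs = map_prod l l ` parcs G \<rparr>"


section \<open>Polynomial rings\<close>

type_synonym 'k mpoly = "(nat \<Rightarrow>\<^sub>0 nat) \<Rightarrow>\<^sub>0 'k"

definition var :: "nat \<Rightarrow> 'k::field mpoly" where
  "var i = Poly_Mapping.single (Poly_Mapping.single i 1) 1"

definition mpoly_ring :: "nat set \<Rightarrow> 'k::field mpoly ring" where
  "mpoly_ring X =
     \<lparr> carrier = {p. \<forall>m \<in> Poly_Mapping.keys p. Poly_Mapping.keys m \<subseteq> X},
       monoid.mult = (*), one = 1, zero = 0, add = (+) \<rparr>"

lemma mpoly_ring_simps [simp]:
  "carrier (mpoly_ring X) = {p. \<forall>m \<in> Poly_Mapping.keys p. Poly_Mapping.keys m \<subseteq> X}"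
  "monoid.mult (mpoly_ring X) = (*)"
  "one (mpoly_ring X) = 1"
  "zero (mpoly_ring X) = 0"
  "add (mpoly_ring X) = (+)"
  by (simp_all add: mpoly_ring_def)

lemma cring_mpoly_ring: "cring (mpoly_ring X :: 'k::field mpoly ring)"
proof (rule cringI)
  show "abelian_group (mpoly_ring X :: 'k mpoly ring)"
  proof (rule abelian_groupI)
    fix p :: "'k mpoly" assume "p \<in> carrier (mpoly_ring X)"
    then show "\<exists>q \<in> carrier (mpoly_ring X). q \<oplus>\<^bsub>mpoly_ring X\<^esub> p = \<zero>\<^bsub>mpoly_ring X\<^esub>"
      by (intro bexI[of _ "- p"]) auto
  qed (use keys_add in \<open>fastforce simp: algebra_simps\<close>)+
  show "comm_monoid (mpoly_ring X :: 'k mpoly ring)"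
  proof (rule comm_monoidI)
    fix p q :: "'k mpoly"
    assume "p \<in> carrier (mpoly_ring X)" "q \<in> carrier (mpoly_ring X)"
    then have *: "\<And>m. m \<in> Poly_Mapping.keys p \<Longrightarrow> Poly_Mapping.keys m \<subseteq> X"
      "\<And>m. m \<in> Poly_Mapping.keys q \<Longrightarrow> Poly_Mapping.keys m \<subseteq> X"
      by auto
    show "p \<otimes>\<^bsub>mpoly_ring X\<^esub> q \<in> carrier (mpoly_ring X)"
    proof (clarsimp)
      fix m i assume "m \<in> Poly_Mapping.keys (p * q)" "i \<in> Poly_Mapping.keys m"
      then obtain a b where "m = a + b" "a \<in> Poly_Mapping.keys p" "b \<in> Poly_Mapping.keys q"
        using keys_mult by blast
      then show "i \<in> X" using * \<open>i \<in> Poly_Mapping.keys m\<close> keys_add[of a b] by blast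
    qed
  qed (auto simp: algebra_simps)
qed (auto simp: algebra_simps)

definition homogeneous :: "'k::field mpoly \<Rightarrow> bool" where
  "homogeneous p \<longleftrightarrow>
     (\<exists>d. \<forall>m \<in> Poly_Mapping.keys p. (\<Sum>i \<in> Poly_Mapping.keys m. Poly_Mapping.lookup m i) = d)"


section \<open>Height, number of generators, complete intersections\<close>

definition prime_height :: "('a, 'b) ring_scheme \<Rightarrow> 'a set \<Rightarrow> enat" where
  "prime_height R P =
     (SUP Ps \<in> {Ps. Ps \<noteq> [] \<and> (\<forall>Q \<in> set Ps. primeideal Q R) \<and>
                    sorted_wrt (\<subset>) Ps \<and> last Ps = P}. enat (length Ps - 1))"

definition ideal_height :: "('a, 'b) ring_scheme \<Rightarrow> 'a set \<Rightarrow> enat" where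
  "ideal_height R I = (INF P \<in> {P. primeideal P R \<and> I \<subseteq> P}. prime_height R P)"

definition minimal_homogeneous_generators ::
    "'k::field mpoly ring \<Rightarrow> 'k mpoly set \<Rightarrow> 'k mpoly set \<Rightarrow> bool" where
  "minimal_homogeneous_generators R I B \<longleftrightarrow>
     finite B \<and> B \<subseteq> carrier R \<and> (\<forall>b \<in> B. homogeneous b) \<and>
     Idl\<^bsub>R\<^esub> B = I \<and> (\<forall>C. C \<subset> B \<longrightarrow> Idl\<^bsub>R\<^esub> C \<noteq> I)"

text \<open>
  By the graded Nakayama lemma, for a homogeneous ideal of a polynomial ring in finitely many
  variables the number below exists and is unique.
\<close>

definition num_generators :: "'k::field mpoly ring \<Rightarrow> 'k mpoly set \<Rightarrow> nat" where
  "num_generators R I = (THE m. \<exists>B. minimal_homogeneous_generators R I B \<and> card B = m)"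

definition complete_intersection :: "'k::field mpoly ring \<Rightarrow> 'k mpoly set \<Rightarrow> bool" where
  "complete_intersection R I \<longleftrightarrow> enat (num_generators R I) = ideal_height R I"


section \<open>Hankel edge ideals\<close>

text \<open>For graphs with vertex set $\{1,\ldots,n\}$.\<close>

definition hankel_ring :: "nat pair_pre_digraph \<Rightarrow> 'k::field mpoly ring" where
  "hankel_ring G = mpoly_ring {1 .. card (pverts G) + 1}"

definition hankel_minor :: "nat \<Rightarrow> nat \<Rightarrow> 'k::field mpoly" where
  "hankel_minor i j = var i * var (j + 1) - var j * var (i + 1)"

definition hankel_edge_ideal :: "nat pair_pre_digraph \<Rightarrow> 'k::field mpoly set" where
  "hankel_edge_ideal G =
     Idl\<^bsub>hankel_ring G\<^esub> {hankel_minor i j | i j. i < j \<and> (i, j) \<in> parcs G}"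

end

theory Submission
  imports Defs "HOL-Computational_Algebra.Polynomial"
begin

text \<open>
  In a rooted labeling the parent \<open>p j\<close> of the vertex \<open>j\<close> is monotone in \<open>j\<close>, and $I_T$ is
  generated by the minors $g_{p(j),j}$.  These $n - 1$ quadrics are linearly independent, so
  $\mu(I_T) = n - 1$ and the question is whether the height of $I_T$ is $n - 1$.

  Heights are bounded from above by transcendence degrees: going down a chain of primes, each
  step adds one algebraically independent element, and at most \<open>card X\<close> polynomials in the
  variables \<open>X\<close> are independent.  They are bounded from below by explicit chains: if
  modulo \<open>P\<close> each of $h$ variables is algebraic over the preceding ones, then $P$ has height at
  least $h$.  The toric prime of the rational normal curve shows that the height of $I_T$ is at
  most $n - 1$.

  For the two good kinds of paths, a prime containing $I_T$ contains either many variables or none,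
  and in each case at most two variables are not algebraic over the preceding ones.
  For all other trees there is a stage of the breadth-first search at which the
  queue is long compared to the number of variables one has to kill to remove the processed
  vertices; killing these variables and taking a toric prime with one ratio for
  each remaining component gives a prime with three independent elements, so the height is at
  most $n - 2$.
\<close>

section \<open>Polynomials in a set of variables\<close>

text \<open>The ring has n + 1 variables, so \<open>d\<close> elements independent modulo a prime
  bound its height by n + 1 - d: two give the expected n - 1, and a third one destroys equality.
  Dually, a lower bound n - 1 tolerates at most two exceptional variables.

  Modulo a prime the generator belonging to j reads x_{p(j)} x_{j+1} = x_j x_{p(j)+1}. As p(j) < j,
  every index except j + 1 is at most j. So x_{j+1} is a fraction in earlier variables unless
  x_{p(j)} vanishes; in that case x_j or x_{p(j)+1} vanishes too. How vanishing spreads along the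
  tree is therefore the whole question for the lower bound.

  For the upper bound, vertex j stands for the column (x_j, x_{j+1}), and neighboring columns share
  an entry. Removing the columns 1, ..., k by killing x_1, ..., x_{k+1} hence damages one more
  column, which becomes (0, x_{k+2}). This is harmless exactly when vertex k + 1 has no children.
  Taking the last possible stage k forces that, by monotonicity of the parent function.\<close>

abbreviation const :: "'k::field \<Rightarrow> 'k mpoly" where
  "const c \<equiv> Poly_Mapping.single 0 c"

definition polys :: "nat set \<Rightarrow> 'k::field mpoly set" where
  "polys X = {p. \<forall>m \<in> Poly_Mapping.keys p. Poly_Mapping.keys m \<subseteq> X}"

lemma carrier_mpoly_ring: "carrier (mpoly_ring X) = polys X"
  by (simp add: polys_def)

declare mpoly_ring_simps(1) [simp del] carrier_mpoly_ring [simp]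

lemma polys_mono: "X \<subseteq> Y \<Longrightarrow> p \<in> polys X \<Longrightarrow> p \<in> polys Y"
  by (force simp: polys_def)

lemma polys_const [simp, intro]: "const c \<in> polys X"
  by (auto simp: polys_def)

lemma polys_0 [simp, intro]: "0 \<in> polys X"
  by (auto simp: polys_def)

lemma polys_1 [simp, intro]: "1 \<in> polys X"
  by (auto simp: polys_def)

lemma polys_var [simp]: "var i \<in> polys X \<longleftrightarrow> i \<in> X"
  by (auto simp: polys_def var_def)

lemma polys_add [intro]: "p \<in> polys X \<Longrightarrow> q \<in> polys X \<Longrightarrow> p + q \<in> polys X"
  using keys_add[of p q] by (auto simp: polys_def)

lemma polys_uminus [intro]: "p \<in> polys X \<Longrightarrow> - p \<in> polys X"
  by (auto simp: polys_def)

lemma polys_diff [intro]: "p \<in> polys X \<Longrightarrow> q \<in> polys X \<Longrightarrow> p - q \<in> polys X"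
  using polys_add[of p X "- q"] by auto

lemma polys_mult [intro]:
  assumes "p \<in> polys X" "q \<in> polys X"
  shows "p * q \<in> polys X"
  unfolding polys_def
proof clarsimp
  fix m i assume "m \<in> Poly_Mapping.keys (p * q)" and i: "i \<in> Poly_Mapping.keys m"
  then obtain a b where "m = a + b" "a \<in> Poly_Mapping.keys p" "b \<in> Poly_Mapping.keys q"
    using keys_mult by blast
  then show "i \<in> X" using assms i keys_add[of a b] unfolding polys_def by blast
qed

lemma polys_power [intro]: "p \<in> polys X \<Longrightarrow> p ^ n \<in> polys X"
  by (induction n) auto

lemma polys_sum [intro]: "(\<And>i. i \<in> A \<Longrightarrow> f i \<in> polys X) \<Longrightarrow> sum f A \<in> polys X"
  by (induction A rule: infinite_finite_induct) auto

lemma polys_prod [intro]: "(\<And>i. i \<in> A \<Longrightarrow> f i \<in> polys X) \<Longrightarrow> prod f A \<in> polys X"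
  by (induction A rule: infinite_finite_induct) auto

lemma sum_single_lookup:
  "(\<Sum>m\<in>Poly_Mapping.keys p. Poly_Mapping.single m (Poly_Mapping.lookup p m)) = p"
proof (rule poly_mapping_eqI)
  fix m
  have "Poly_Mapping.lookup (\<Sum>m\<in>Poly_Mapping.keys p. Poly_Mapping.single m (Poly_Mapping.lookup p m)) m
     = (\<Sum>k\<in>Poly_Mapping.keys p. if k = m then Poly_Mapping.lookup p k else 0)"
    by (simp add: lookup_sum lookup_single when_def)
  also have "\<dots> = Poly_Mapping.lookup p m"
    by (simp add: in_keys_iff)
  finally show "Poly_Mapping.lookup (\<Sum>m\<in>Poly_Mapping.keys p. Poly_Mapping.single m (Poly_Mapping.lookup p m)) m
     = Poly_Mapping.lookup p m" .
qed

lemma var_power: "var i ^ k = Poly_Mapping.single (Poly_Mapping.single i k) 1"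
  by (induction k) (simp_all add: var_def mult_single flip: single_add)

lemma single_conv_prod_var:
  "Poly_Mapping.single m c =
     const c * (\<Prod>i\<in>Poly_Mapping.keys m. var i ^ Poly_Mapping.lookup m i)"
proof -
  have *: "(\<Prod>i\<in>A. Poly_Mapping.single (Poly_Mapping.single i (Poly_Mapping.lookup m i)) (1::'a))
     = Poly_Mapping.single (\<Sum>i\<in>A. Poly_Mapping.single i (Poly_Mapping.lookup m i)) 1" for A
    by (induction A rule: infinite_finite_induct) (simp_all add: mult_single)
  show ?thesis
    by (simp add: var_power * sum_single_lookup mult_single)
qed

text \<open>Closure properties and identities between ring homomorphisms need to be checked only on
  constants and variables; this spares most later arguments any computation with monomials.\<close>

lemma polys_induct [consumes 1, case_names const var add mult]:
  fixes p :: "'k::field mpoly"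
  assumes p: "p \<in> polys X"
    and c: "\<And>c. P (const c)" and v: "\<And>i. i \<in> X \<Longrightarrow> P (var i)"
    and a: "\<And>p q. p \<in> polys X \<Longrightarrow> q \<in> polys X \<Longrightarrow> P p \<Longrightarrow> P q \<Longrightarrow> P (p + q)"
    and m: "\<And>p q. p \<in> polys X \<Longrightarrow> q \<in> polys X \<Longrightarrow> P p \<Longrightarrow> P q \<Longrightarrow> P (p * q)"
  shows "P p"
proof -
  have P01: "P 0" "P 1"
    using c[of 0] c[of 1] by simp_all
  have pw: "P (var i ^ k) \<and> (var i ^ k :: 'k mpoly) \<in> polys X" if "i \<in> X" for i k
    using that P01 by (induction k) (auto intro!: m v)
  have pr: "P (\<Prod>i\<in>A. var i ^ g i) \<and> (\<Prod>i\<in>A. var i ^ g i :: 'k mpoly) \<in> polys X" if "A \<subseteq> X" for A g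
    using that
  proof (induction A rule: infinite_finite_induct)
    case (insert x F)
    then show ?case using pw[of x "g x"] m[of "var x ^ g x" "\<Prod>i\<in>F. var i ^ g i"] by auto
  qed (simp_all add: P01)
  have mon: "P (Poly_Mapping.single k c) \<and> (Poly_Mapping.single k c :: 'k mpoly) \<in> polys X"
    if "Poly_Mapping.keys k \<subseteq> X" for k c
    unfolding single_conv_prod_var[of k c] using pr[OF that] c by (auto intro: m)
  have "P (\<Sum>m\<in>A. Poly_Mapping.single m (Poly_Mapping.lookup p m)) \<and>
        (\<Sum>m\<in>A. Poly_Mapping.single m (Poly_Mapping.lookup p m)) \<in> polys X"
    if "A \<subseteq> Poly_Mapping.keys p" for A
    using that
  proof (induction A rule: infinite_finite_induct)
    case (insert x F)
    then have "Poly_Mapping.keys x \<subseteq> X" using p by (auto simp: polys_def)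
    then show ?case using insert mon[of x] by (auto intro!: a polys_add)
  qed (simp_all add: P01)
  from this[OF order_refl] show ?thesis by (simp add: sum_single_lookup)
qed

section \<open>Substitution\<close>

definition power_product :: "(nat \<Rightarrow> 'r::comm_ring_1) \<Rightarrow> (nat \<Rightarrow>\<^sub>0 nat) \<Rightarrow> 'r" where
  "power_product f m = (\<Prod>i\<in>Poly_Mapping.keys m. f i ^ Poly_Mapping.lookup m i)"

text \<open>The coefficient map is a parameter because two targets occur: the polynomial ring itself
  for \<open>subst\<close>, and univariate polynomials over it for \<open>as_poly\<close>.\<close>

definition insertion :: "('k::field \<Rightarrow> 'r::comm_ring_1) \<Rightarrow> (nat \<Rightarrow> 'r) \<Rightarrow> 'k mpoly \<Rightarrow> 'r" where
  "insertion h f p = (\<Sum>m\<in>Poly_Mapping.keys p. h (Poly_Mapping.lookup p m) * power_product f m)"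

lemma power_product_superset:
  assumes "finite A" "Poly_Mapping.keys m \<subseteq> A"
  shows "power_product f m = (\<Prod>i\<in>A. f i ^ Poly_Mapping.lookup m i)"
  unfolding power_product_def using assms
  by (intro prod.mono_neutral_left) (auto simp: in_keys_iff)

lemma power_product_0 [simp]: "power_product f 0 = 1"
  by (simp add: power_product_def)

lemma power_product_add: "power_product f (a + b) = power_product f a * power_product f b"
proof -
  define A where "A = Poly_Mapping.keys a \<union> Poly_Mapping.keys b"
  have "finite A" "Poly_Mapping.keys a \<subseteq> A" "Poly_Mapping.keys b \<subseteq> A" "Poly_Mapping.keys (a + b) \<subseteq> A"
    using keys_add[of a b] by (auto simp: A_def)
  then show ?thesis
    by (simp add: power_product_superset[of A] lookup_add power_add prod.distrib)
qed

locale coeff_hom =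
  fixes h :: "'k::field \<Rightarrow> 'r::comm_ring_1"
  assumes hom_0 [simp]: "h 0 = 0" and hom_1 [simp]: "h 1 = 1"
    and hom_add: "h (a + b) = h a + h b" and hom_mult: "h (a * b) = h a * h b"
begin

lemma insertion_superset:
  assumes "finite A" "Poly_Mapping.keys p \<subseteq> A"
  shows "insertion h f p = (\<Sum>m\<in>A. h (Poly_Mapping.lookup p m) * power_product f m)"
  unfolding insertion_def using assms
  by (intro sum.mono_neutral_left) (auto simp: in_keys_iff)

lemma insertion_add: "insertion h f (p + q) = insertion h f p + insertion h f q"
proof -
  define A where "A = Poly_Mapping.keys p \<union> Poly_Mapping.keys q"
  have "finite A" "Poly_Mapping.keys p \<subseteq> A" "Poly_Mapping.keys q \<subseteq> A" "Poly_Mapping.keys (p + q) \<subseteq> A"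
    using keys_add[of p q] by (auto simp: A_def)
  then show ?thesis
    by (simp add: insertion_superset[of A] lookup_add hom_add sum.distrib algebra_simps)
qed

lemma insertion_0 [simp]: "insertion h f 0 = 0"
  by (simp add: insertion_def)

lemma insertion_sum: "insertion h f (\<Sum>i\<in>A. g i) = (\<Sum>i\<in>A. insertion h f (g i))"
  by (induction A rule: infinite_finite_induct) (auto simp: insertion_add)

lemma insertion_single: "insertion h f (Poly_Mapping.single m c) = h c * power_product f m"
  by (cases "c = 0") (simp_all add: insertion_def)

lemma insertion_const [simp]: "insertion h f (const c) = h c"
  by (simp add: insertion_single)

lemma insertion_1 [simp]: "insertion h f 1 = 1"
  using insertion_const[of f 1] by simp

lemma insertion_var [simp]: "insertion h f (var i) = f i"
  by (simp add: var_def insertion_single power_product_def)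

lemma insertion_mult: "insertion h f (p * q) = insertion h f p * insertion h f q"
proof -
  let ?s = "\<lambda>p m. Poly_Mapping.single m (Poly_Mapping.lookup p m)"
  have "p * q = (\<Sum>a\<in>Poly_Mapping.keys p. ?s p a) * (\<Sum>b\<in>Poly_Mapping.keys q. ?s q b)"
    by (simp add: sum_single_lookup)
  also have "\<dots> = (\<Sum>a\<in>Poly_Mapping.keys p. \<Sum>b\<in>Poly_Mapping.keys q. ?s p a * ?s q b)"
    by (simp add: sum_product)
  finally have "insertion h f (p * q) =
      (\<Sum>a\<in>Poly_Mapping.keys p. \<Sum>b\<in>Poly_Mapping.keys q. insertion h f (?s p a * ?s q b))"
    by (simp add: insertion_sum)
  also have "\<dots> = insertion h f p * insertion h f q"
    unfolding insertion_def[of h f p] insertion_def[of h f q]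
    by (simp add: mult_single insertion_single hom_mult power_product_add sum_product algebra_simps)
  finally show ?thesis .
qed

lemma insertion_uminus: "insertion h f (- p) = - insertion h f p"
  using insertion_add[of f p "- p"] by (simp add: eq_neg_iff_add_eq_0 add.commute)

lemma insertion_diff: "insertion h f (p - q) = insertion h f p - insertion h f q"
  using insertion_add[of f p "- q"] by (simp add: insertion_uminus)

lemma insertion_cong:
  assumes "p \<in> polys X" and "\<And>i. i \<in> X \<Longrightarrow> f i = g i"
  shows "insertion h f p = insertion h g p"
  using assms by (induction rule: polys_induct) (simp_all add: insertion_add insertion_mult)

end

abbreviation subst :: "(nat \<Rightarrow> 'k::field mpoly) \<Rightarrow> 'k mpoly \<Rightarrow> 'k mpoly" where
  "subst \<equiv> insertion const"

interpretation subst: coeff_hom "const :: 'k::field \<Rightarrow> 'k mpoly"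
  by unfold_locales (simp_all add: single_add mult_single)

lemma subst_polys:
  assumes "p \<in> polys X" and "\<And>i. i \<in> X \<Longrightarrow> f i \<in> polys Y"
  shows "subst f p \<in> polys Y"
  using assms by (induction rule: polys_induct) (auto simp: subst.insertion_add subst.insertion_mult)

lemma subst_subst:
  "subst f (subst g p) = subst (\<lambda>i. subst f (g i)) p"
proof -
  have "p \<in> polys UNIV" by (auto simp: polys_def)
  then show ?thesis
    by (induction rule: polys_induct) (simp_all add: subst.insertion_add subst.insertion_mult)
qed

lemma subst_var_id:
  assumes "p \<in> polys X" "\<And>i. i \<in> X \<Longrightarrow> f i = var i"
  shows "subst f p = p"
  using assms by (induction rule: polys_induct) (simp_all add: subst.insertion_add subst.insertion_mult)

text \<open>This is the view of the ring as univariate polynomials in \<open>var b\<close> over the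
  other variables. The coefficients stay in the full type; \<open>coeff_as_poly_polys\<close>
  records that \<open>var b\<close> no longer occurs in them.\<close>

definition as_poly :: "nat \<Rightarrow> 'k::field mpoly \<Rightarrow> 'k mpoly poly" where
  "as_poly b = insertion (\<lambda>c. [:const c:]) (\<lambda>i. if i = b then [:0, 1:] else [:var i:])"

interpretation as_poly: coeff_hom "(\<lambda>c. [:const c:]) :: 'k::field \<Rightarrow> 'k mpoly poly"
  by unfold_locales (simp_all add: single_add mult_single one_pCons mult.commute)

lemma as_poly_add: "as_poly b (p + q) = as_poly b p + as_poly b q"
  and as_poly_diff: "as_poly b (p - q) = as_poly b p - as_poly b q"
  and as_poly_mult: "as_poly b (p * q) = as_poly b p * as_poly b q"
  and as_poly_const: "as_poly b (const c) = [:const c:]"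
  and as_poly_0: "as_poly b 0 = 0"
  and as_poly_1: "as_poly b 1 = 1"
  and as_poly_var: "as_poly b (var i) = (if i = b then [:0, 1:] else [:var i:])"
  by (simp_all add: as_poly_def as_poly.insertion_add as_poly.insertion_mult
      as_poly.insertion_diff)

lemma poly_as_poly: "poly (as_poly b p) (var b) = p"
proof -
  have "p \<in> polys UNIV" by (auto simp: polys_def)
  then show ?thesis
    by (induction rule: polys_induct) (simp_all add: as_poly_add as_poly_mult as_poly_const as_poly_var)
qed

lemma coeff_as_poly_polys:
  assumes "p \<in> polys X"
  shows "coeff (as_poly b p) i \<in> polys (X - {b})"
  using assms
proof (induction arbitrary: i rule: polys_induct)
  case (mult p q)
  then show ?case by (auto simp: as_poly_mult coeff_mult)
next
  case (const c)
  then show ?case by (cases i) (auto simp: as_poly_const)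
next
  case (var j)
  then show ?case by (auto simp: as_poly_var coeff_pCons split: nat.split)
qed (auto simp: as_poly_add)

lemma as_poly_free:
  assumes "p \<in> polys X" "b \<notin> X"
  shows "as_poly b p = [:p:]"
  using assms by (induction rule: polys_induct)
    (auto simp: as_poly_add as_poly_mult as_poly_const as_poly_var)

section \<open>Prime ideals and algebraic independence\<close>

lemma ideal_mpolyI:
  fixes P :: "'k::field mpoly set"
  assumes R: "P \<subseteq> polys X" "0 \<in> P" "\<And>p q. p \<in> P \<Longrightarrow> q \<in> P \<Longrightarrow> p + q \<in> P"
    "\<And>p r. p \<in> P \<Longrightarrow> r \<in> polys X \<Longrightarrow> r * p \<in> P"
  shows "ideal P (mpoly_ring X)"
proof -
  have c: "carrier (mpoly_ring X) = (polys X :: 'k mpoly set)" by (rule carrier_mpoly_ring)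
  interpret cring "mpoly_ring X :: 'k mpoly ring" by (rule cring_mpoly_ring)
  have inv: "\<ominus>\<^bsub>mpoly_ring X\<^esub> p = - p" if "p \<in> polys X" for p :: "'k mpoly"
    by (rule minus_equality) (use that in \<open>simp_all add: polys_uminus\<close>)
  have um: "- p \<in> P" if "p \<in> P" for p
  proof -
    have "const (-1) * p \<in> P" using R that by blast
    then show ?thesis by (simp add: single_uminus)
  qed
  show "ideal P (mpoly_ring X)"
  proof (rule idealI)
    show "ring (mpoly_ring X :: 'k mpoly ring)" by (rule ring_axioms)
    show "subgroup P (add_monoid (mpoly_ring X))"
    proof (rule add.subgroupI)
      show "P \<subseteq> carrier (mpoly_ring X)" using R c by metis
      show "P \<noteq> {}" using R by blast
      fix p assume p: "p \<in> P"
      then have "p \<in> polys X" using R by blast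
      then show "\<ominus>\<^bsub>mpoly_ring X\<^esub> p \<in> P" using inv um[OF p] by simp
    next
      fix p q :: "'k mpoly" assume "p \<in> P" "q \<in> P"
      then show "p \<oplus>\<^bsub>mpoly_ring X\<^esub> q \<in> P" using R by simp
    qed
    fix p r :: "'k mpoly" assume "p \<in> P" "r \<in> carrier (mpoly_ring X)"
    then have "r * p \<in> P" unfolding c using R by blast
    then show "r \<otimes>\<^bsub>mpoly_ring X\<^esub> p \<in> P" "p \<otimes>\<^bsub>mpoly_ring X\<^esub> r \<in> P"
      by (simp_all add: mult.commute)
  qed
qed

lemma primeideal_mpoly_iff:
  fixes P :: "'k::field mpoly set"
  shows "primeideal P (mpoly_ring X) \<longleftrightarrow>
     P \<subseteq> polys X \<and> 0 \<in> P \<and> 1 \<notin> P \<and> (\<forall>p\<in>P. \<forall>q\<in>P. p + q \<in> P) \<and>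
     (\<forall>p\<in>P. \<forall>r\<in>polys X. r * p \<in> P) \<and>
     (\<forall>p\<in>polys X. \<forall>q\<in>polys X. p * q \<in> P \<longrightarrow> p \<in> P \<or> q \<in> P)" (is "?L \<longleftrightarrow> ?R")
proof
  assume ?L
  then interpret primeideal P "mpoly_ring X" .
  interpret additive_subgroup P "mpoly_ring X" by (rule is_additive_subgroup)
  have c: "carrier (mpoly_ring X) = (polys X :: 'k mpoly set)" by (rule carrier_mpoly_ring)
  have f3: "1 \<notin> P"
  proof
    assume "1 \<in> P"
    then have "P = carrier (mpoly_ring X)" using one_imp_carrier by simp
    then show False using I_notcarr by metis
  qed
  have f1: "P \<subseteq> polys X" using a_subset c by metis
  have f2: "0 \<in> P" using additive_subgroup.zero_closed[OF is_additive_subgroup] by simp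
  have f4: "p + q \<in> P" if "p \<in> P" "q \<in> P" for p q
    using additive_subgroup.a_closed[OF is_additive_subgroup that] by simp
  have f5: "r * p \<in> P" if "p \<in> P" "r \<in> polys X" for p r
    using I_l_closed[OF that(1)] that(2) unfolding c by simp
  have f6: "p \<in> P \<or> q \<in> P" if "p * q \<in> P" "p \<in> polys X" "q \<in> polys X" for p q
    using I_prime[of p q] that unfolding c by simp
  show ?R using f1 f2 f3 f4 f5 f6 by simp
next
  assume R: ?R
  have "ideal P (mpoly_ring X)" using R by (intro ideal_mpolyI) auto
  then show ?L
  proof (rule primeidealI)
    show "cring (mpoly_ring X :: 'k mpoly ring)" by (rule cring_mpoly_ring)
    show "carrier (mpoly_ring X) \<noteq> P" using R polys_1[of X] by auto
    fix p q :: "'k mpoly" assume "p \<in> carrier (mpoly_ring X)" "q \<in> carrier (mpoly_ring X)" "p \<otimes>\<^bsub>mpoly_ring X\<^esub> q \<in> P"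
    then show "p \<in> P \<or> q \<in> P" using R by simp
  qed
qed

lemma var_nonzero [simp]: "(var i :: 'k::field mpoly) \<noteq> 0"
proof -
  have "Poly_Mapping.keys (var i :: 'k mpoly) \<noteq> {}" by (simp add: var_def)
  then show ?thesis by force
qed

lemma
  assumes "primeideal P (mpoly_ring X)"
  shows prime_subset: "P \<subseteq> polys X"
    and prime_0: "0 \<in> P"
    and prime_1: "1 \<notin> P"
    and prime_add: "p \<in> P \<Longrightarrow> q \<in> P \<Longrightarrow> p + q \<in> P"
    and prime_lmult: "p \<in> P \<Longrightarrow> r \<in> polys X \<Longrightarrow> r * p \<in> P"
    and prime_rmult: "p \<in> P \<Longrightarrow> r \<in> polys X \<Longrightarrow> p * r \<in> P"
    and prime_disj: "p * q \<in> P \<Longrightarrow> p \<in> polys X \<Longrightarrow> q \<in> polys X \<Longrightarrow> p \<in> P \<or> q \<in> P"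
  using assms[unfolded primeideal_mpoly_iff] by (simp_all add: mult.commute)

lemma prime_uminus:
  assumes "primeideal P (mpoly_ring X)" "p \<in> P"
  shows "- p \<in> P"
  using prime_lmult[OF assms, of "const (-1)"] by (simp add: single_uminus polys_uminus)

lemma prime_diff:
  assumes "primeideal P (mpoly_ring X)" "p \<in> P" "q \<in> P"
  shows "p - q \<in> P"
  using prime_add[OF assms(1,2) prime_uminus[OF assms(1,3)]] by simp

lemma prime_add_left_iff:
  assumes "primeideal P (mpoly_ring X)" "q \<in> P"
  shows "p + q \<in> P \<longleftrightarrow> p \<in> P"
  using prime_diff[OF assms(1) _ assms(2), of "p + q"] prime_add[OF assms(1) _ assms(2), of p] by auto

lemma prime_sum:
  assumes "primeideal P (mpoly_ring X)" "\<And>i. i \<in> A \<Longrightarrow> f i \<in> P"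
  shows "sum f A \<in> P"
  using assms(2) by (induction A rule: infinite_finite_induct)
    (auto intro: prime_0[OF assms(1)] prime_add[OF assms(1)])

section \<open>Algebraic independence modulo an ideal\<close>

definition alg_indep :: "'k::field mpoly set \<Rightarrow> (nat \<Rightarrow> 'k mpoly) \<Rightarrow> nat \<Rightarrow> bool" where
  "alg_indep Q f d \<longleftrightarrow> (\<forall>c \<in> polys {..<d}. subst f c \<in> Q \<longrightarrow> c = 0)"

lemma polys_empty_conv: "c \<in> polys {} \<Longrightarrow> \<exists>k. c = const k"
proof (induction rule: polys_induct)
  case (add p q)
  then show ?case by (metis single_add)
next
  case (mult p q)
  then show ?case by (metis mult_single add_0)
qed auto

lemma alg_indep_0: "1 \<notin> Q \<Longrightarrow> (\<And>p r. p \<in> Q \<Longrightarrow> const r * p \<in> Q) \<Longrightarrow> alg_indep Q f 0"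
  unfolding alg_indep_def
proof safe
  fix c :: "'a mpoly"
  assume Q: "1 \<notin> Q" "\<And>p r. p \<in> Q \<Longrightarrow> const r * p \<in> Q" and "c \<in> polys {..<0}" and c: "subst f c \<in> Q"
  then obtain k where k: "c = const k" using polys_empty_conv[of c] by auto
  show "c = 0"
  proof (rule ccontr)
    assume "c \<noteq> 0"
    then have "const (inverse k) * subst f c = 1" using k by (cases "k = 0") (auto simp: mult_single)
    then show False using Q c by metis
  qed
qed

text \<open>Splitting off the last variable turns independence into a statement about univariate
  polynomials over the remaining ones, which is accessible to induction on \<open>pCons\<close>.\<close>

lemma alg_indep_SucI:
  fixes f :: "nat \<Rightarrow> 'k::field mpoly"
  assumes "\<And>p q. p \<in> polys {..<d} \<Longrightarrow> q \<in> polys {..<Suc d} \<Longrightarrow>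
      subst f p + f d * subst f q \<in> Q \<Longrightarrow> p = 0 \<and> subst f q \<in> Q"
  shows "alg_indep Q f (Suc d)"
  unfolding alg_indep_def
proof safe
  fix c :: "'k mpoly"
  assume c: "c \<in> polys {..<Suc d}" "subst f c \<in> Q"
  define P where "P = as_poly d c"
  have cP: "c = poly P (var d)" unfolding P_def by (rule poly_as_poly[symmetric])
  have "coeff P i \<in> polys {..<d}" for i
    using coeff_as_poly_polys[OF c(1), of d i] unfolding P_def
    by (rule polys_mono[rotated]) auto
  moreover have "subst f (poly P (var d)) \<in> Q" using c(2) cP by simp
  ultimately have "P = 0"
  proof (induction P)
    case (pCons a P)
    have co: "coeff P i \<in> polys {..<d}" for i using pCons(3)[of "Suc i"] by simp
    then have "poly P (var d) \<in> polys {..<Suc d}"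
      unfolding poly_altdef by (intro polys_sum polys_mult polys_power) (auto intro: polys_mono[of "{..<d}"])
    moreover have "a \<in> polys {..<d}" using pCons(3)[of 0] by simp
    ultimately have "a = 0 \<and> subst f (poly P (var d)) \<in> Q"
      using pCons(4) by (intro assms) (simp_all add: subst.insertion_add subst.insertion_mult)
    then show ?case using pCons.IH[OF co] by simp
  qed simp
  then show "c = 0" using cP by simp
qed

text \<open>Reduce a relation modulo \<open>P\<close>, where \<open>g\<close> vanishes: its part
  free of \<open>g\<close> is a relation among the old elements and must be zero. The rest is
  divisible by \<open>g\<close>, and \<open>g\<close> can be cancelled because \<open>Q\<close> is
  prime and does not contain it.\<close>

lemma alg_indep_step:
  fixes f :: "nat \<Rightarrow> 'k::field mpoly"
  assumes P: "primeideal P (mpoly_ring X)" and Q: "primeideal Q (mpoly_ring X)"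
    and sub: "Q \<subseteq> P" and g: "g \<in> P" "g \<notin> Q"
    and f: "\<And>i. i < d \<Longrightarrow> f i \<in> polys X" and ind: "alg_indep P f d"
  shows "alg_indep Q (f(d := g)) (Suc d)"
proof (rule alg_indep_SucI)
  fix p q :: "'k mpoly"
  let ?f = "f(d := g)"
  assume p: "p \<in> polys {..<d}" and q: "q \<in> polys {..<Suc d}"
    and pq: "subst ?f p + ?f d * subst ?f q \<in> Q"
  have gX: "g \<in> polys X" using g(1) prime_subset[OF P] by blast
  have sq: "subst ?f q \<in> polys X"
    by (rule subst_polys[OF q]) (auto simp: f gX)
  have sp: "subst ?f p = subst f p" by (rule subst.insertion_cong[OF p]) auto
  have "g * subst ?f q \<in> P" using prime_rmult[OF P g(1) sq] .
  then have "subst f p \<in> P" using pq sub prime_add_left_iff[OF P] sp by auto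
  then have p0: "p = 0" using ind p by (auto simp: alg_indep_def)
  then have "g * subst ?f q \<in> Q" using pq by simp
  then have "subst ?f q \<in> Q" using prime_disj[OF Q _ gX sq] g(2) by blast
  then show "p = 0 \<and> subst ?f q \<in> Q" using p0 by simp
qed

text \<open>The same argument with the substitution of 0 for \<open>var w\<close> in place of the
  reduction modulo a prime: it fixes the old elements and kills the new one.\<close>

lemma alg_indep_triangular:
  fixes f :: "nat \<Rightarrow> 'k::field mpoly"
  assumes ind: "alg_indep {0} f d" and f: "\<And>i. i < d \<Longrightarrow> f i \<in> polys (UNIV - {w})"
    and t: "f d = t * var w" "t \<noteq> 0"
  shows "alg_indep {0} f (Suc d)"
proof (rule alg_indep_SucI)
  fix p q :: "'k mpoly"
  assume p: "p \<in> polys {..<d}" and q: "q \<in> polys {..<Suc d}"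
    and "subst f p + f d * subst f q \<in> {0}"
  then have *: "subst f p + f d * subst f q = 0" by simp
  let ?z = "\<lambda>i. if i = w then 0 else var i"
  have "subst ?z (subst f p) = subst f p"
  proof (rule subst_var_id)
    show "subst f p \<in> polys (UNIV - {w})" by (rule subst_polys[OF p]) (use f in auto)
  qed auto
  moreover have "subst ?z (f d) = 0" by (simp add: t subst.insertion_mult)
  moreover have "subst ?z (subst f p + f d * subst f q) = 0" by (simp add: *)
  ultimately have "subst f p = 0" by (simp add: subst.insertion_add subst.insertion_mult)
  then have "p = 0" using ind p by (auto simp: alg_indep_def)
  moreover have "f d \<noteq> 0" using t by simp
  ultimately show "p = 0 \<and> subst f q \<in> {0}" using * by simp
qed

lemma prime_chain_length:
  fixes f :: "nat \<Rightarrow> 'k::field mpoly"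
  assumes "Ps \<noteq> []" "\<forall>Q\<in>set Ps. primeideal Q (mpoly_ring X)" "sorted_wrt (\<subset>) Ps"
    "\<And>i. i < d \<Longrightarrow> f i \<in> polys X" "alg_indep (last Ps) f d"
  shows "\<exists>g. (\<forall>i < d + length Ps - 1. g i \<in> polys X) \<and> alg_indep (hd Ps) g (d + length Ps - 1)"
  using assms
proof (induction Ps)
  case (Cons Q Ps)
  show ?case
  proof (cases "Ps = []")
    case True
    then show ?thesis using Cons.prems by auto
  next
    case False
    then obtain g where g: "\<forall>i < d + length Ps - 1. g i \<in> polys X"
      "alg_indep (hd Ps) g (d + length Ps - 1)"
      using Cons by auto
    have hd: "hd Ps \<in> set Ps" using False by simp
    then obtain x where x: "x \<in> hd Ps" "x \<notin> Q" using Cons.prems(3) by auto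
    define G where "G = g(d + length Ps - 1 := x)"
    have l: "Suc (d + length Ps - 1) = d + length Ps" using False by (cases Ps) auto
    have "alg_indep Q G (Suc (d + length Ps - 1))"
      unfolding G_def using Cons.prems hd x g by (intro alg_indep_step[of "hd Ps" X]) auto
    then have "alg_indep Q G (d + length Ps)" unfolding l .
    moreover have "x \<in> polys X" using Cons.prems(2) hd x(1) prime_subset[of "hd Ps" X] by auto
    then have "\<forall>i < d + length Ps. G i \<in> polys X"
      using g(1) l unfolding G_def by (metis fun_upd_apply less_Suc_eq)
    ultimately show ?thesis by (intro exI[of _ G]) simp
  qed
qed simp

section \<open>Linear algebra\<close>

interpretation mpoly: vector_space "\<lambda>c (p :: 'k::field mpoly). const c * p"
  by unfold_locales (simp_all add: algebra_simps single_add mult_single flip: mult.assoc)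

section \<open>Counting monomials to bound the number of independent polynomials\<close>

definition box :: "nat set \<Rightarrow> nat \<Rightarrow> (nat \<Rightarrow>\<^sub>0 nat) set" where
  "box X k = {m. Poly_Mapping.keys m \<subseteq> X \<and> (\<forall>i. Poly_Mapping.lookup m i < k)}"

lemma card_box:
  assumes "finite X" "k > 0"
  shows "card (box X k) = k ^ card X" and "finite (box X k)"
proof -
  have "bij_betw (\<lambda>m. restrict (Poly_Mapping.lookup m) X) (box X k) (PiE X (\<lambda>_. {..<k}))"
  proof (rule bij_betwI)
    show "(\<lambda>m. restrict (Poly_Mapping.lookup m) X) \<in> box X k \<rightarrow> PiE X (\<lambda>_. {..<k})"
      by (auto simp: box_def)
    let ?g = "\<lambda>g. Abs_poly_mapping (\<lambda>i. if i \<in> X then g i else (0::nat))"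
    have lk: "Poly_Mapping.lookup (?g g) = (\<lambda>i. if i \<in> X then g i else 0)" for g
      using assms(1) by (intro lookup_Abs_poly_mapping) (auto elim: finite_subset[rotated])
    show "?g \<in> PiE X (\<lambda>_. {..<k}) \<rightarrow> box X k"
      using assms(2) by (auto simp: box_def lk in_keys_iff split: if_splits)
    show "?g (restrict (Poly_Mapping.lookup m) X) = m" if "m \<in> box X k" for m
      using that by (intro poly_mapping_eqI) (auto simp: lk box_def in_keys_iff)
    show "restrict (Poly_Mapping.lookup (?g g)) X = g" if "g \<in> PiE X (\<lambda>_. {..<k})" for g
      using that by (auto simp: lk fun_eq_iff PiE_def extensional_def)
  qed
  then show "card (box X k) = k ^ card X" "finite (box X k)"
    using assms bij_betw_finite finite_PiE[of X "\<lambda>_. {..<k}"]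
    by (auto simp: bij_betw_same_card card_PiE)
qed

text \<open>Each exponent is bounded, not the total degree, so that the admissible monomials fill a
  box, whose size is a plain power.\<close>

definition exps_le :: "nat \<Rightarrow> 'k::field mpoly \<Rightarrow> bool" where
  "exps_le k p \<longleftrightarrow> (\<forall>m\<in>Poly_Mapping.keys p. \<forall>i. Poly_Mapping.lookup m i \<le> k)"

lemma exps_le_mono: "exps_le k p \<Longrightarrow> k \<le> l \<Longrightarrow> exps_le l p"
  unfolding exps_le_def by (meson order_trans)

lemma exps_le_1 [simp]: "exps_le k 1"
  by (auto simp: exps_le_def)

lemma exps_le_mult: "exps_le k p \<Longrightarrow> exps_le l q \<Longrightarrow> exps_le (k + l) (p * q)"
  unfolding exps_le_def
proof safe
  fix m i assume a: "\<forall>m\<in>Poly_Mapping.keys p. \<forall>i. Poly_Mapping.lookup m i \<le> k"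
    "\<forall>m\<in>Poly_Mapping.keys q. \<forall>i. Poly_Mapping.lookup m i \<le> l" "m \<in> Poly_Mapping.keys (p * q)"
  then obtain x y where "m = x + y" "x \<in> Poly_Mapping.keys p" "y \<in> Poly_Mapping.keys q"
    using keys_mult by blast
  then show "Poly_Mapping.lookup m i \<le> k + l" using a by (simp add: lookup_add add_mono)
qed

lemma exps_le_power: "exps_le k p \<Longrightarrow> exps_le (n * k) (p ^ n)"
  by (induction n) (auto intro: exps_le_mult)

lemma exps_le_prod: "(\<And>i. i \<in> A \<Longrightarrow> exps_le k (f i)) \<Longrightarrow> exps_le (card A * k) (prod f A)"
  by (induction A rule: infinite_finite_induct) (auto intro: exps_le_mult)

lemma exps_le_exists: "\<exists>k. exps_le k p"
proof -
  let ?S = "\<Union>m\<in>Poly_Mapping.keys p. Poly_Mapping.lookup m ` Poly_Mapping.keys m"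
  have "Poly_Mapping.lookup m i \<le> Max (insert 0 ?S)" if "m \<in> Poly_Mapping.keys p" for m i
  proof (cases "i \<in> Poly_Mapping.keys m")
    case True
    then show ?thesis using that by (intro Max_ge) auto
  qed (simp add: in_keys_iff)
  then show ?thesis unfolding exps_le_def by blast
qed

lemma polys_box_span:
  assumes "p \<in> polys X" "exps_le k p"
  shows "p \<in> mpoly.span ((\<lambda>m. Poly_Mapping.single m 1) ` box X (Suc k))"
proof -
  have "(\<Sum>m\<in>Poly_Mapping.keys p. const (Poly_Mapping.lookup p m) * Poly_Mapping.single m 1)
     \<in> mpoly.span ((\<lambda>m. Poly_Mapping.single m 1) ` box X (Suc k))"
    using assms by (intro mpoly.span_sum mpoly.span_scale mpoly.span_base)
      (auto simp: box_def polys_def exps_le_def le_imp_less_Suc)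
  then show ?thesis by (simp add: mult_single sum_single_lookup)
qed

text \<open>The $e^d$ power products of the \<open>f i\<close> with exponents below $e$ would be linearly independent,
  but they lie in a space of dimension \<open>O(e ^ card X)\<close>.\<close>

lemma alg_indep_card_le:
  fixes f :: "nat \<Rightarrow> 'k::field mpoly"
  assumes X: "finite X" and f: "\<And>i. i < d \<Longrightarrow> f i \<in> polys X" and ind: "alg_indep {0} f d"
  shows "d \<le> card X"
proof (rule ccontr)
  assume "\<not> d \<le> card X"
  then have d: "card X < d" by simp
  have "\<forall>i. \<exists>k. exps_le k (f i)" using exps_le_exists by blast
  then obtain D0 where D0: "\<And>i. exps_le (D0 i) (f i)" by metis
  define D where "D = (\<Sum>i<d. D0 i)"
  have D: "exps_le D (f i)" if "i < d" for i
    using D0[of i] exps_le_mono that member_le_sum[of i "{..<d}" D0] unfolding D_def by blast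
  \<comment> \<open>By the choice of \<open>a\<close>, the number
    \<open>Suc (d * (e * D)) ^ card X\<close> of available monomials is at most
    \<open>(a * e) ^ card X\<close>. As \<open>e\<close> exceeds \<open>a ^ card X\<close>, this is
    less than \<open>e ^ Suc (card X)\<close>, hence less than the number \<open>e ^ d\<close> of
    power products.\<close>
  define a where "a = d * D + 1"
  define e where "e = a ^ card X + 1"
  define B where "B = box {..<d} e"
  have e0: "e > 0" by (simp add: e_def)
  let ?M = "power_product f"
  have M: "?M m = (\<Prod>i<d. f i ^ Poly_Mapping.lookup m i)" if "m \<in> B" for m
    using that by (intro power_product_superset) (auto simp: B_def box_def)
  have Mle: "exps_le (d * (e * D)) (?M m)" if "m \<in> B" for m
  proof -
    have "exps_le (card {..<d} * (e * D)) (\<Prod>i<d. f i ^ Poly_Mapping.lookup m i)"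
    proof (rule exps_le_prod)
      fix i assume "i \<in> {..<d}"
      then show "exps_le (e * D) (f i ^ Poly_Mapping.lookup m i)"
        using that D by (intro exps_le_mono[OF exps_le_power mult_le_mono1])
          (auto simp: B_def box_def intro: less_imp_le)
    qed
    then show ?thesis using M[OF that] by simp
  qed
  have MX: "?M m \<in> polys X" if "m \<in> B" for m
    unfolding M[OF that] by (intro polys_prod polys_power f) auto
  have key: "c = 0" if "c \<in> polys {..<d}" "subst f c = 0" for c
    using ind that by (auto simp: alg_indep_def)
  have comb: "\<forall>m\<in>A. u m = 0" if A: "A \<subseteq> B" "finite A" "(\<Sum>m\<in>A. const (u m) * ?M m) = 0" for A u
  proof -
    define c where "c = (\<Sum>m\<in>A. Poly_Mapping.single m (u m))"
    have "subst f c = 0"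
      unfolding c_def using A(3) by (simp add: subst.insertion_sum subst.insertion_single)
    moreover have "c \<in> polys {..<d}"
      unfolding c_def using A(1) by (intro polys_sum) (auto simp: B_def box_def polys_def)
    ultimately have "c = 0" using key by blast
    moreover have "Poly_Mapping.lookup c m = u m" if "m \<in> A" for m
      using that A(2) by (simp add: c_def lookup_sum lookup_single when_def)
    ultimately show ?thesis by simp
  qed
  \<comment> \<open>Two exponents with the same power product would satisfy a relation with
    coefficients 1 and -1. Injectivity is what makes the image have \<open>e ^ d\<close>
    elements.\<close>
  have inj: "inj_on ?M B"
  proof (rule inj_onI, rule ccontr)
    fix x y assume xy: "x \<in> B" "y \<in> B" "?M x = ?M y" "x \<noteq> y"
    have "\<forall>m\<in>{x, y}. (if m = x then 1 else -1 :: 'k) = 0"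
      using xy by (intro comb) (auto simp: single_uminus)
    then show False by auto
  qed
  have fin: "finite B" and cB: "card B = e ^ d"
    using card_box[of "{..<d}" e] e0 by (auto simp: B_def)
  have indep: "mpoly.independent (?M ` B)"
    unfolding mpoly.dependent_explicit
  proof
    assume "\<exists>t u. finite t \<and> t \<subseteq> ?M ` B \<and> (\<Sum>v\<in>t. const (u v) * v) = 0 \<and> (\<exists>v\<in>t. u v \<noteq> 0)"
    then obtain t u v where t: "t \<subseteq> ?M ` B" "(\<Sum>v\<in>t. const (u v) * v) = 0" "v \<in> t" "u v \<noteq> 0"
      by blast
    then obtain A where A: "A \<subseteq> B" "t = ?M ` A" using t(1) unfolding subset_image_iff by blast
    have "finite A" using A(1) fin by (rule finite_subset)
    moreover have "(\<Sum>m\<in>A. const (u (?M m)) * ?M m) = 0"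
      using t(2) A inj_on_subset[OF inj A(1)] by (simp add: sum.reindex)
    ultimately have "\<forall>m\<in>A. u (?M m) = 0" using comb[of A "\<lambda>m. u (?M m)"] A(1) by blast
    then show False using t(3,4) A(2) by auto
  qed
  have fb: "finite (box X (Suc (d * (e * D))))" using card_box(2)[OF X] by simp
  have "?M ` B \<subseteq> mpoly.span ((\<lambda>m. Poly_Mapping.single m 1) ` box X (Suc (d * (e * D))))"
    using Mle MX polys_box_span by blast
  then have "card (?M ` B) \<le> card ((\<lambda>m. Poly_Mapping.single m (1::'k)) ` box X (Suc (d * (e * D))))"
    using mpoly.independent_span_bound[OF finite_imageI[OF fb] indep] by simp
  also have "\<dots> \<le> card (box X (Suc (d * (e * D))))" by (rule card_image_le[OF fb])
  also have "\<dots> = Suc (d * (e * D)) ^ card X" using card_box(1)[OF X] by simp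
  also have "\<dots> \<le> (a * e) ^ card X"
    using e0 by (intro power_mono) (auto simp: a_def algebra_simps)
  also have "\<dots> = a ^ card X * e ^ card X" by (simp add: power_mult_distrib)
  also have "\<dots> < e * e ^ card X" using e0 by (intro mult_strict_right_mono) (auto simp: e_def)
  also have "\<dots> = e ^ Suc (card X)" by simp
  also have "\<dots> \<le> e ^ d" using d e0 by (intro power_increasing) auto
  finally show False using card_image[OF inj] cB by simp
qed

lemma prime_height_le:
  fixes f :: "nat \<Rightarrow> 'k::field mpoly"
  assumes X: "finite X" and f: "\<And>i. i < d \<Longrightarrow> f i \<in> polys X" and ind: "alg_indep P f d"
  shows "prime_height (mpoly_ring X) P \<le> enat (card X - d)"
  unfolding prime_height_def
proof (rule SUP_least, clarify)
  fix Ps assume Ps: "Ps \<noteq> []" "\<forall>Q\<in>set Ps. primeideal Q (mpoly_ring X)" "sorted_wrt (\<subset>) Ps" "P = last Ps"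
  have "alg_indep (last Ps) f d" using ind Ps(4) by simp
  from prime_chain_length[OF Ps(1-3) f this]
  obtain g where g: "\<forall>i < d + length Ps - 1. g i \<in> polys X"
     "alg_indep (hd Ps) g (d + length Ps - 1)"
    by auto
  have "primeideal (hd Ps) (mpoly_ring X)" using Ps(1,2) by simp
  then have "0 \<in> hd Ps" by (rule prime_0)
  then have "alg_indep {0} g (d + length Ps - 1)" using g(2) by (auto simp: alg_indep_def)
  then have "d + length Ps - 1 \<le> card X" using g(1) by (intro alg_indep_card_le[OF X]) auto
  then show "enat (length Ps - 1) \<le> enat (card X - d)" by simp
qed

lemma subst_kernel_prime:
  fixes f :: "nat \<Rightarrow> 'k::field mpoly"
  shows "primeideal {p \<in> polys X. subst f p = 0} (mpoly_ring X)"
  unfolding primeideal_mpoly_iff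
  by (auto simp: subst.insertion_add subst.insertion_mult)

text \<open>Substitutions compose, so a relation between the variables \<open>var (v i)\<close>
  modulo the kernel is the same thing as a relation between their images.\<close>

lemma subst_kernel_height_le:
  fixes f :: "nat \<Rightarrow> 'k::field mpoly"
  assumes "finite X" "\<And>i. i < d \<Longrightarrow> v i \<in> X" "alg_indep {0} (\<lambda>i. f (v i)) d"
  shows "prime_height (mpoly_ring X) {p \<in> polys X. subst f p = 0} \<le> enat (card X - d)"
proof (rule prime_height_le[OF assms(1)])
  show "var (v i) \<in> polys X" if "i < d" for i using assms(2)[OF that] by simp
  show "alg_indep {p \<in> polys X. subst f p = 0} (\<lambda>i. var (v i)) d"
    using assms(3) by (auto simp: alg_indep_def subst_subst)
qed

section \<open>Lower bounds for heights\<close>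

text \<open>For a prime \<open>P\<close>, this is the extension to \<open>polys X\<close> of the contraction of \<open>P\<close> to
  the polynomials that do not involve \<open>var b\<close>.\<close>

definition coeff_ideal :: "nat \<Rightarrow> nat set \<Rightarrow> 'k::field mpoly set \<Rightarrow> 'k mpoly set" where
  "coeff_ideal b X P = {p \<in> polys X. \<forall>i. coeff (as_poly b p) i \<in> P}"

lemma coeff_as_poly_polys': "p \<in> polys X \<Longrightarrow> coeff (as_poly b p) i \<in> polys X"
  using coeff_as_poly_polys polys_mono by (metis Diff_subset)

text \<open>Gauss's lemma. If neither factor lies in the ideal, take in each the lowest coefficient
  outside \<open>P\<close>. In the coefficient of the product at the sum of the two indices, every
  other summand lies in \<open>P\<close>, so the product of these two coefficients would lie in
  \<open>P\<close> as well.\<close>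

lemma coeff_ideal_prime:
  fixes P :: "'k::field mpoly set"
  assumes P: "primeideal P (mpoly_ring X)"
  shows "primeideal (coeff_ideal b X P) (mpoly_ring X)"
  unfolding primeideal_mpoly_iff
proof (intro conjI ballI impI)
  show "coeff_ideal b X P \<subseteq> polys X" "0 \<in> coeff_ideal b X P"
    using prime_0[OF P] by (auto simp: coeff_ideal_def as_poly_0)
  show "1 \<notin> coeff_ideal b X P"
  proof
    assume "1 \<in> coeff_ideal b X P"
    then have "coeff (as_poly b (1 :: 'k mpoly)) 0 \<in> P" unfolding coeff_ideal_def by blast
    then show False using prime_1[OF P] by (simp add: as_poly_1)
  qed
  fix p q :: "'k mpoly" assume p: "p \<in> coeff_ideal b X P"
  {
    assume "q \<in> coeff_ideal b X P"
    then show "p + q \<in> coeff_ideal b X P"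
      using p prime_add[OF P] by (auto simp: coeff_ideal_def as_poly_add)
  next
    assume "q \<in> polys X"
    then show "q * p \<in> coeff_ideal b X P"
      using p by (auto simp: coeff_ideal_def as_poly_mult coeff_mult coeff_as_poly_polys'
          intro!: prime_sum[OF P] prime_lmult[OF P])
  }
next
  fix p q :: "'k mpoly" assume p: "p \<in> polys X" and q: "q \<in> polys X" and pq: "p * q \<in> coeff_ideal b X P"
  let ?p = "coeff (as_poly b p)" and ?q = "coeff (as_poly b q)"
  show "p \<in> coeff_ideal b X P \<or> q \<in> coeff_ideal b X P"
  proof (rule ccontr)
    assume "\<not> ?thesis"
    then have ex: "\<exists>i. ?p i \<notin> P" "\<exists>i. ?q i \<notin> P" using p q by (auto simp: coeff_ideal_def)
    define i where "i = (LEAST i. ?p i \<notin> P)"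
    define j where "j = (LEAST i. ?q i \<notin> P)"
    have i: "?p i \<notin> P" "\<And>k. k < i \<Longrightarrow> ?p k \<in> P"
      using LeastI_ex[OF ex(1)] not_less_Least unfolding i_def by blast+
    have j: "?q j \<notin> P" "\<And>k. k < j \<Longrightarrow> ?q k \<in> P"
      using LeastI_ex[OF ex(2)] not_less_Least unfolding j_def by blast+
    have "(\<Sum>k\<le>i + j. ?p k * ?q (i + j - k)) \<in> P"
      using pq unfolding coeff_ideal_def by (simp add: as_poly_mult coeff_mult)
    also have "(\<Sum>k\<le>i + j. ?p k * ?q (i + j - k)) =
        ?p i * ?q j + (\<Sum>k\<in>{..i + j} - {i}. ?p k * ?q (i + j - k))"
      by (subst sum.remove[of _ i]) auto
    finally have *: "?p i * ?q j + (\<Sum>k\<in>{..i + j} - {i}. ?p k * ?q (i + j - k)) \<in> P" .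
    have "(\<Sum>k\<in>{..i + j} - {i}. ?p k * ?q (i + j - k)) \<in> P"
    proof (rule prime_sum[OF P])
      fix k assume k: "k \<in> {..i + j} - {i}"
      show "?p k * ?q (i + j - k) \<in> P"
      proof (cases "k < i")
        case True
        then show ?thesis using i(2) by (intro prime_rmult[OF P] coeff_as_poly_polys' q)
      next
        case False
        then have "i + j - k < j" using k by auto
        then show ?thesis using j(2) by (intro prime_lmult[OF P] coeff_as_poly_polys' p)
      qed
    qed
    then have "?p i * ?q j \<in> P" using * prime_add_left_iff[OF P] by blast
    then show False using prime_disj[OF P] i(1) j(1) coeff_as_poly_polys' p q by blast
  qed
qed

lemma coeff_ideal_subset:
  assumes P: "primeideal P (mpoly_ring X)" and b: "b \<in> X"
  shows "coeff_ideal b X P \<subseteq> P"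
proof
  fix p assume p: "p \<in> coeff_ideal b X P"
  have "poly (as_poly b p) (var b) \<in> P"
    unfolding poly_altdef using p b
    by (intro prime_sum[OF P] prime_rmult[OF P] polys_power) (auto simp: coeff_ideal_def)
  then show "p \<in> P" by (simp add: poly_as_poly)
qed

lemma coeff_ideal_free:
  assumes "p \<in> polys Y" "b \<notin> Y" "Y \<subseteq> X" "p \<in> P" "0 \<in> P"
  shows "p \<in> coeff_ideal b X P"
  using as_poly_free[OF assms(1,2)] polys_mono[OF assms(3,1)] assms(4,5)
  by (auto simp: coeff_ideal_def coeff_pCons split: nat.split)

lemma sorted_psubset_last:
  "sorted_wrt (\<subset>) Ps \<Longrightarrow> Q \<in> set Ps \<Longrightarrow> Q \<subseteq> last Ps"
  by (induction Ps) (auto split: if_splits)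

text \<open>The chain is built downwards, removing the largest variable \<open>b\<close> of
  \<open>B\<close> first. The relation for a smaller variable does not involve \<open>b\<close>, so
  it survives the passage from \<open>P\<close> to \<open>coeff_ideal b X P\<close>. The relation
  for \<open>b\<close> itself does not survive, which makes the inclusion strict.\<close>

lemma prime_chain_exists:
  fixes P :: "'k::field mpoly set"
  assumes "finite B" "B \<subseteq> X" "primeideal P (mpoly_ring X)"
    and "\<And>b. b \<in> B \<Longrightarrow> \<exists>u\<in>polys (X \<inter> {..<b}). \<exists>v\<in>polys (X \<inter> {..<b}). u \<notin> P \<and> u * var b - v \<in> P"
  shows "\<exists>Ps. Ps \<noteq> [] \<and> (\<forall>Q\<in>set Ps. primeideal Q (mpoly_ring X)) \<and> sorted_wrt (\<subset>) Ps \<and>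
           last Ps = P \<and> length Ps = card B + 1"
  using assms
proof (induction B arbitrary: P rule: finite_linorder_max_induct)
  case empty
  then show ?case by (intro exI[of _ "[P]"]) auto
next
  case (insert b A)
  note P = \<open>primeideal P (mpoly_ring X)\<close>
  let ?Q = "coeff_ideal b X P"
  have b: "b \<in> X" using insert.prems by auto
  have sub: "?Q \<subseteq> P" by (rule coeff_ideal_subset[OF P b])
  have pQ: "primeideal ?Q (mpoly_ring X)" by (rule coeff_ideal_prime[OF P])
  have "\<exists>Ps. Ps \<noteq> [] \<and> (\<forall>Q\<in>set Ps. primeideal Q (mpoly_ring X)) \<and> sorted_wrt (\<subset>) Ps \<and>
           last Ps = ?Q \<and> length Ps = card A + 1"
  proof (rule insert.IH[OF _ pQ])
    show "A \<subseteq> X" using insert.prems by auto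
    fix a assume a: "a \<in> A"
    then obtain u v where uv: "u \<in> polys (X \<inter> {..<a})" "v \<in> polys (X \<inter> {..<a})" "u \<notin> P" "u * var a - v \<in> P"
      using insert.prems(3) by blast
    have ab: "a < b" "a \<in> X" using a insert.hyps insert.prems by auto
    have "X \<inter> {..<a} \<subseteq> X \<inter> {..<b}" using ab by auto
    then have "u \<in> polys (X \<inter> {..<b})" "v \<in> polys (X \<inter> {..<b})"
      using uv(1,2) polys_mono by metis+
    then have "u * var a - v \<in> polys (X \<inter> {..<b})"
      using ab by (intro polys_diff polys_mult) auto
    then have "u * var a - v \<in> ?Q"
      using uv(4) prime_0[OF P] by (intro coeff_ideal_free[where Y = "X \<inter> {..<b}"]) auto
    then show "\<exists>u\<in>polys (X \<inter> {..<a}). \<exists>v\<in>polys (X \<inter> {..<a}). u \<notin> ?Q \<and> u * var a - v \<in> ?Q"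
      using uv sub by blast
  qed
  then obtain Ps where Ps: "Ps \<noteq> []" "\<forall>Q\<in>set Ps. primeideal Q (mpoly_ring X)" "sorted_wrt (\<subset>) Ps"
    "last Ps = ?Q" "length Ps = card A + 1" by blast
  obtain u v where uv: "u \<in> polys (X \<inter> {..<b})" "v \<in> polys (X \<inter> {..<b})" "u \<notin> P" "u * var b - v \<in> P"
    using insert.prems(3) by blast
  \<comment> \<open>The leading coefficient of the relation is outside \<open>P\<close>, so the
    relation cannot belong to the smaller prime.\<close>
  have "coeff (as_poly b (u * var b - v)) 1 = u"
    using as_poly_free[OF uv(1), of b] as_poly_free[OF uv(2), of b]
    by (simp add: as_poly_diff as_poly_mult as_poly_var)
  then have "u * var b - v \<notin> ?Q" using uv(3) unfolding coeff_ideal_def by (metis (mono_tags, lifting) mem_Collect_eq)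
  then have "?Q \<subset> P" using sub uv(4) by blast
  then have "\<forall>Q\<in>set Ps. Q \<subset> P"
    using sorted_psubset_last[OF Ps(3)] unfolding Ps(4) by (meson subset_psubset_trans)
  moreover have "b \<notin> A" using insert.hyps by auto
  ultimately show ?case
    using Ps P insert.hyps by (intro exI[of _ "Ps @ [P]"]) (auto simp: sorted_wrt_append)
qed

lemma prime_height_ge:
  fixes P :: "'k::field mpoly set"
  assumes "finite B" "B \<subseteq> X" "primeideal P (mpoly_ring X)"
    and "\<And>b. b \<in> B \<Longrightarrow> \<exists>u\<in>polys (X \<inter> {..<b}). \<exists>v\<in>polys (X \<inter> {..<b}). u \<notin> P \<and> u * var b - v \<in> P"
  shows "enat (card B) \<le> prime_height (mpoly_ring X) P"
proof -
  obtain Ps where Ps: "Ps \<noteq> []" "\<forall>Q\<in>set Ps. primeideal Q (mpoly_ring X)" "sorted_wrt (\<subset>) Ps"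
    "last Ps = P" "length Ps = card B + 1"
    using prime_chain_exists[OF assms] by blast
  then show ?thesis
    unfolding prime_height_def by (intro SUP_upper2[of Ps]) auto
qed

section \<open>Minimal generators of ideals generated by forms of one degree\<close>

definition mdeg :: "(nat \<Rightarrow>\<^sub>0 nat) \<Rightarrow> nat" where
  "mdeg m = (\<Sum>i\<in>Poly_Mapping.keys m. Poly_Mapping.lookup m i)"

lemma mdeg_add: "mdeg (a + b) = mdeg a + mdeg b"
proof -
  define A where "A = Poly_Mapping.keys a \<union> Poly_Mapping.keys b"
  have "mdeg m = sum (Poly_Mapping.lookup m) A" if "Poly_Mapping.keys m \<subseteq> A" for m
    unfolding mdeg_def using that
    by (intro sum.mono_neutral_left) (auto simp: A_def in_keys_iff)
  moreover have "Poly_Mapping.keys a \<subseteq> A" "Poly_Mapping.keys b \<subseteq> A" "Poly_Mapping.keys (a + b) \<subseteq> A"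
    using keys_add[of a b] by (auto simp: A_def)
  ultimately show ?thesis by (simp add: lookup_add sum.distrib)
qed

text \<open>This is membership in the power with exponent \<open>d\<close> of the ideal generated by
  all variables.\<close>

definition order_ge :: "nat \<Rightarrow> 'k::field mpoly \<Rightarrow> bool" where
  "order_ge d p \<longleftrightarrow> (\<forall>m\<in>Poly_Mapping.keys p. d \<le> mdeg m)"

definition form :: "nat \<Rightarrow> 'k::field mpoly \<Rightarrow> bool" where
  "form d p \<longleftrightarrow> (\<forall>m\<in>Poly_Mapping.keys p. mdeg m = d)"

lemma homogeneous_iff_form: "homogeneous p \<longleftrightarrow> (\<exists>d. form d p)"
  by (simp add: homogeneous_def form_def mdeg_def)

lemma order_ge_0 [simp]: "order_ge d 0" and form_0 [simp]: "form d 0"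
  by (simp_all add: order_ge_def form_def)

lemma order_ge_trivial [simp]: "order_ge 0 p"
  by (simp add: order_ge_def)

lemma order_ge_add: "order_ge d p \<Longrightarrow> order_ge d q \<Longrightarrow> order_ge d (p + q)"
  using keys_add[of p q] by (auto simp: order_ge_def)

lemma form_add: "form d p \<Longrightarrow> form d q \<Longrightarrow> form d (p + q)"
  using keys_add[of p q] by (auto simp: form_def)

lemma order_ge_mult: "order_ge a p \<Longrightarrow> order_ge b q \<Longrightarrow> order_ge (a + b) (p * q)"
  using keys_mult[of p q] by (force simp: order_ge_def mdeg_add intro: add_mono)

lemma form_mult: "form a p \<Longrightarrow> form b q \<Longrightarrow> form (a + b) (p * q)"
  using keys_mult[of p q] by (force simp: form_def mdeg_add)

lemma form_const [simp]: "form 0 (const c)"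
  by (simp add: form_def mdeg_def)

lemma form_uminus: "form d p \<Longrightarrow> form d (- p)"
  by (simp add: form_def)

lemma form_diff: "form d p \<Longrightarrow> form d q \<Longrightarrow> form d (p - q)"
  using form_add[of d p "- q"] by (simp add: form_uminus)

lemma form_order_ge: "form d p \<Longrightarrow> order_ge d p"
  by (auto simp: form_def order_ge_def)

lemma form_order_ge_Suc: "form d p \<Longrightarrow> order_ge (Suc d) p \<Longrightarrow> p = 0"
  unfolding form_def order_ge_def by (metis keys_eq_empty not_less_eq_eq order_refl ex_in_conv)

lemma form_cases: "form e p \<Longrightarrow> order_ge d p \<Longrightarrow> form d p \<or> order_ge (Suc d) p"
  unfolding form_def order_ge_def by (metis le_antisym not_less_eq_eq)

lemma order_ge_1_diff_const: "order_ge 1 (r - const (Poly_Mapping.lookup r 0))"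
proof -
  have "mdeg m \<noteq> 0" if "m \<noteq> 0" for m
    using that unfolding mdeg_def by (auto simp: in_keys_iff simp flip: keys_eq_empty)
  then show ?thesis
    by (auto simp: order_ge_def in_keys_iff lookup_minus lookup_single when_def Suc_le_eq split: if_splits)
qed

section \<open>Generated ideals and their forms of lowest degree\<close>

lemma genideal_mpoly:
  fixes B :: "'k::field mpoly set"
  assumes "B \<subseteq> polys X"
  shows "ideal (Idl\<^bsub>mpoly_ring X\<^esub> B) (mpoly_ring X)" "B \<subseteq> Idl\<^bsub>mpoly_ring X\<^esub> B"
    "\<And>J. ideal J (mpoly_ring X) \<Longrightarrow> B \<subseteq> J \<Longrightarrow> Idl\<^bsub>mpoly_ring X\<^esub> B \<subseteq> J"
proof -
  interpret cring "mpoly_ring X :: 'k mpoly ring" by (rule cring_mpoly_ring)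
  show "ideal (Idl\<^bsub>mpoly_ring X\<^esub> B) (mpoly_ring X)" "B \<subseteq> Idl\<^bsub>mpoly_ring X\<^esub> B"
    "\<And>J. ideal J (mpoly_ring X) \<Longrightarrow> B \<subseteq> J \<Longrightarrow> Idl\<^bsub>mpoly_ring X\<^esub> B \<subseteq> J"
    using assms by (auto intro!: genideal_ideal genideal_self dest: genideal_minimal)
qed

lemma
  fixes I :: "'k::field mpoly set"
  assumes "ideal I (mpoly_ring X)"
  shows ideal_mpoly_subset: "I \<subseteq> polys X"
    and ideal_mpoly_0: "0 \<in> I"
    and ideal_mpoly_add: "p \<in> I \<Longrightarrow> q \<in> I \<Longrightarrow> p + q \<in> I"
    and ideal_mpoly_lmult: "p \<in> I \<Longrightarrow> r \<in> polys X \<Longrightarrow> r * p \<in> I"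
proof -
  interpret ideal I "mpoly_ring X" by fact
  show "I \<subseteq> polys X" using a_subset by simp
  show "0 \<in> I" using additive_subgroup.zero_closed[OF is_additive_subgroup] by simp
  show "p + q \<in> I" if "p \<in> I" "q \<in> I"
    using additive_subgroup.a_closed[OF is_additive_subgroup that] by simp
  show "r * p \<in> I" if "p \<in> I" "r \<in> polys X" using I_l_closed[OF that(1)] that(2) by simp
qed

lemma genideal_mpoly_mono:
  assumes "C \<subseteq> Idl\<^bsub>mpoly_ring X\<^esub> B" "B \<subseteq> polys X"
  shows "Idl\<^bsub>mpoly_ring X\<^esub> C \<subseteq> Idl\<^bsub>mpoly_ring X\<^esub> B"
  using assms genideal_mpoly(1)[OF assms(2)] ideal_mpoly_subset genideal_mpoly(3)[of C X] by blast

lemma span_subset_genideal: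
  assumes "C \<subseteq> polys X"
  shows "mpoly.span C \<subseteq> Idl\<^bsub>mpoly_ring X\<^esub> C"
proof -
  note id = genideal_mpoly(1)[OF assms]
  show ?thesis
  proof (rule mpoly.span_minimal[OF genideal_mpoly(2)[OF assms]])
    show "mpoly.subspace (Idl\<^bsub>mpoly_ring X\<^esub> C)"
      by (rule mpoly.subspaceI)
        (auto intro: ideal_mpoly_0[OF id] ideal_mpoly_add[OF id] ideal_mpoly_lmult[OF id])
  qed
qed

lemma span_form:
  assumes "\<And>c. c \<in> C \<Longrightarrow> form d c" "s \<in> mpoly.span C"
  shows "form d s"
proof -
  have "mpoly.subspace {s. form d s}"
    by (rule mpoly.subspaceI) (auto intro: form_add simp: form_mult[of 0, simplified])
  then show ?thesis using assms mpoly.span_minimal[of C "{s. form d s}"] by auto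
qed

text \<open>The core of the graded Nakayama lemma. Up to terms of degree above \<open>d\<close>, a
  polynomial \<open>r\<close> acts on a form of degree \<open>d\<close> through its constant term.
  The polynomials whose part of degree up to \<open>d\<close> lies in the span therefore form an
  ideal, and it contains all generators.\<close>

lemma genideal_leading_form:
  fixes B :: "'k::field mpoly set"
  assumes B: "B \<subseteq> polys X" and d: "\<And>b. b \<in> B \<Longrightarrow> form d b \<or> order_ge (Suc d) b"
  shows "Idl\<^bsub>mpoly_ring X\<^esub> B \<subseteq>
     {q. \<exists>s\<in>mpoly.span {b \<in> B. form d b}. order_ge (Suc d) (q - s)}"
proof -
  define S where "S = mpoly.span {b \<in> B. form d b}"
  define J where "J = {q \<in> polys X. \<exists>s\<in>S. order_ge (Suc d) (q - s)}"
  have JI: "q \<in> J" if "q \<in> polys X" "s \<in> S" "order_ge (Suc d) (q - s)" for q s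
    using that unfolding J_def by blast
  have JX: "q \<in> polys X" if "q \<in> J" for q
    using that unfolding J_def by blast
  have JE: "\<exists>s. s \<in> S \<and> order_ge (Suc d) (q - s)" if "q \<in> J" for q
    using that unfolding J_def by blast
  have S0: "0 \<in> S" unfolding S_def by (rule mpoly.span_zero)
  have "ideal J (mpoly_ring X)"
  proof (rule ideal_mpolyI)
    show "J \<subseteq> polys X" using JX by (rule subsetI)
    show "0 \<in> J" by (rule JI[OF polys_0 S0]) simp
  next
    fix p q assume p: "p \<in> J" and q: "q \<in> J"
    obtain s t where *: "s \<in> S" "t \<in> S" "order_ge (Suc d) (p - s)" "order_ge (Suc d) (q - t)"
      using JE[OF p] JE[OF q] by (elim exE conjE)
    show "p + q \<in> J"
    proof (rule JI)
      show "p + q \<in> polys X" by (rule polys_add[OF JX[OF p] JX[OF q]])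
      show "s + t \<in> S" using *(1,2) unfolding S_def by (rule mpoly.span_add)
      have "p + q - (s + t) = (p - s) + (q - t)" by simp
      then show "order_ge (Suc d) (p + q - (s + t))" using order_ge_add[OF *(3,4)] by (simp only:)
    qed
  next
    fix p r :: "'k mpoly" assume p: "p \<in> J" and r: "r \<in> polys X"
    obtain s where *: "s \<in> S" "order_ge (Suc d) (p - s)" using JE[OF p] by (elim exE conjE)
    define c where "c = const (Poly_Mapping.lookup r 0)"
    show "r * p \<in> J"
    proof (rule JI)
      show "r * p \<in> polys X" by (rule polys_mult[OF r JX[OF p]])
      show "c * s \<in> S" using *(1) unfolding S_def c_def by (rule mpoly.span_scale)
      have "form d s" by (rule span_form[OF _ *(1)[unfolded S_def]]) simp
      then have "order_ge (1 + d) ((r - c) * s)"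
        unfolding c_def by (intro order_ge_mult order_ge_1_diff_const form_order_ge)
      moreover have "order_ge (0 + Suc d) (r * (p - s))"
        by (intro order_ge_mult order_ge_trivial *)
      ultimately have "order_ge (Suc d) ((r - c) * s + r * (p - s))" using order_ge_add[of "Suc d"] by simp
      moreover have "r * p - c * s = (r - c) * s + r * (p - s)" by (simp add: algebra_simps)
      ultimately show "order_ge (Suc d) (r * p - c * s)" by (simp only:)
    qed
  qed
  moreover have "B \<subseteq> J"
  proof
    fix b assume b: "b \<in> B"
    then have bX: "b \<in> polys X" using B by (rule rev_subsetD)
    show "b \<in> J"
    proof (cases "form d b")
      case True
      then have "b \<in> S" unfolding S_def using b by (intro mpoly.span_base) simp
      then show ?thesis using bX by (intro JI[of b b]) simp_all
    next
      case False
      then show ?thesis using bX S0 d[OF b] by (intro JI[of b 0]) simp_all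
    qed
  qed
  ultimately have "Idl\<^bsub>mpoly_ring X\<^esub> B \<subseteq> J" by (rule genideal_mpoly(3)[OF B])
  then show ?thesis unfolding J_def S_def by blast
qed

lemma genideal_forms_span:
  assumes "B \<subseteq> polys X" "\<And>b. b \<in> B \<Longrightarrow> form d b \<or> order_ge (Suc d) b"
    and "p \<in> Idl\<^bsub>mpoly_ring X\<^esub> B" "form d p"
  shows "p \<in> mpoly.span {b \<in> B. form d b}"
proof -
  obtain s where s: "s \<in> mpoly.span {b \<in> B. form d b}" "order_ge (Suc d) (p - s)"
    using genideal_leading_form[OF assms(1,2)] assms(3) by blast
  have "form d s" by (rule span_form[OF _ s(1)]) simp
  then have "p = s" using form_order_ge_Suc[OF form_diff[OF assms(4)] s(2)] by simp
  then show ?thesis using s(1) by simp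
qed

lemma genideal_forms_order_ge:
  assumes "G \<subseteq> polys X" "\<And>g. g \<in> G \<Longrightarrow> form d g" "p \<in> Idl\<^bsub>mpoly_ring X\<^esub> G"
  shows "order_ge d p"
proof -
  obtain s where s: "s \<in> mpoly.span {g \<in> G. form d g}" "order_ge (Suc d) (p - s)"
    using genideal_leading_form[OF assms(1), of d] assms(2,3) by blast
  have "order_ge d s" by (rule form_order_ge, rule span_form[OF _ s(1)]) simp
  moreover have "order_ge d (p - s)" using s(2) by (force simp: order_ge_def)
  ultimately have "order_ge d (s + (p - s))" by (rule order_ge_add)
  then show ?thesis by simp
qed

text \<open>A minimal homogeneous generating set turns out to be a basis of the space spanned by
  \<open>G\<close>: it consists of forms of degree \<open>d\<close>, it spans the same space, and a
  linear dependence in it would contradict minimality. So all such sets have the cardinality of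
  \<open>G\<close>.\<close>

lemma num_generators_forms:
  fixes G :: "'k::field mpoly set"
  assumes fin: "finite G" and G: "G \<subseteq> polys X" and form: "\<And>g. g \<in> G \<Longrightarrow> form d g"
    and ind: "mpoly.independent G"
  shows "num_generators (mpoly_ring X) (Idl\<^bsub>mpoly_ring X\<^esub> G) = card G"
proof -
  let ?R = "mpoly_ring X :: 'k mpoly ring"
  let ?I = "Idl\<^bsub>?R\<^esub> G"
  have "minimal_homogeneous_generators ?R ?I G"
    unfolding minimal_homogeneous_generators_def
  proof (intro conjI allI impI ballI fin refl)
    show "G \<subseteq> carrier ?R" using G by simp
    show "homogeneous g" if "g \<in> G" for g using form[OF that] homogeneous_iff_form by blast
    fix C assume C: "C \<subset> G"
    show "Idl\<^bsub>?R\<^esub> C \<noteq> ?I"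
    proof
      assume eq: "Idl\<^bsub>?R\<^esub> C = ?I"
      obtain g where g: "g \<in> G" "g \<notin> C" using C by blast
      have "g \<in> mpoly.span {b \<in> C. form d b}"
        using C G form g genideal_mpoly(2)[OF G] eq by (intro genideal_forms_span[where X = X]) auto
      moreover have "{b \<in> C. form d b} \<subseteq> G - {g}" using C g by blast
      ultimately have "g \<in> mpoly.span (G - {g})" using mpoly.span_mono by blast
      then show False using ind g(1) unfolding mpoly.dependent_def by blast
    qed
  qed
  note G_min = this
  have unique: "card B = card G" if "minimal_homogeneous_generators ?R ?I B" for B
  proof -
    from that have B: "finite B" "B \<subseteq> polys X" "\<And>b. b \<in> B \<Longrightarrow> homogeneous b" "Idl\<^bsub>?R\<^esub> B = ?I"
      "\<And>C. C \<subset> B \<Longrightarrow> Idl\<^bsub>?R\<^esub> C \<noteq> ?I"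
      unfolding minimal_homogeneous_generators_def by auto
    have BI: "B \<subseteq> ?I" using genideal_mpoly(2)[OF B(2)] B(4) by simp
    have GI: "G \<subseteq> Idl\<^bsub>?R\<^esub> B" using genideal_mpoly(2)[OF G] B(4) by simp
    have cs: "form d b \<or> order_ge (Suc d) b" if "b \<in> B" for b
    proof -
      have "order_ge d b" by (rule genideal_forms_order_ge[OF G form]) (use BI that in auto)
      then show ?thesis using B(3)[OF that] form_cases homogeneous_iff_form by blast
    qed
    let ?C = "{b \<in> B. form d b}"
    have GC: "G \<subseteq> mpoly.span ?C"
      using genideal_forms_span[OF B(2) cs] GI form by blast
    have gen: "Idl\<^bsub>?R\<^esub> C = ?I" if C: "C \<subseteq> B" "G \<subseteq> mpoly.span C" for C
    proof
      have CX: "C \<subseteq> polys X" using C B(2) by blast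
      show "?I \<subseteq> Idl\<^bsub>?R\<^esub> C"
        using genideal_mpoly_mono[OF _ CX] C(2) span_subset_genideal[OF CX] by blast
      show "Idl\<^bsub>?R\<^esub> C \<subseteq> ?I" using genideal_mpoly_mono[OF _ G] C(1) BI by blast
    qed
    \<comment> \<open>The members of degree \<open>d\<close> generate the ideal on their own, so
      minimality excludes any of higher order.\<close>
    have "?C = B" using gen[of ?C] GC B(5)[of ?C] by blast
    then have fB: "form d b" if "b \<in> B" for b using that by blast
    have GB: "G \<subseteq> mpoly.span B" using GC \<open>?C = B\<close> by simp
    have "{g \<in> G. form d g} = G" using form by blast
    then have BG: "B \<subseteq> mpoly.span G"
      using genideal_forms_span[OF G, of d] form BI fB by auto
    have "mpoly.independent B"
      unfolding mpoly.dependent_def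
    proof
      assume "\<exists>a\<in>B. a \<in> mpoly.span (B - {a})"
      then obtain a where a: "a \<in> B" "a \<in> mpoly.span (B - {a})" by blast
      have "B \<subseteq> mpoly.span (B - {a})"
      proof
        fix b assume "b \<in> B"
        then show "b \<in> mpoly.span (B - {a})" using a(2) by (cases "b = a") (auto intro: mpoly.span_base)
      qed
      then have "mpoly.span B \<subseteq> mpoly.span (B - {a})" by (rule mpoly.span_minimal[OF _ mpoly.subspace_span])
      then have "Idl\<^bsub>?R\<^esub> (B - {a}) = ?I" using gen[of "B - {a}"] GB by blast
      then show False using B(5)[of "B - {a}"] a(1) by blast
    qed
    then show ?thesis
      using mpoly.independent_span_bound[OF B(1) ind GB] mpoly.independent_span_bound[OF fin _ BG] by simp
  qed
  show ?thesis
    unfolding num_generators_def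
  proof (rule the_equality)
    show "\<exists>B. minimal_homogeneous_generators ?R ?I B \<and> card B = card G"
      by (rule exI[of _ G], rule conjI[OF G_min refl])
    show "m = card G" if "\<exists>B. minimal_homogeneous_generators ?R ?I B \<and> card B = m" for m
      using that unique by (elim exE conjE) simp
  qed
qed

section \<open>Hankel edge ideals of trees with monotone parent function\<close>

lemma var_mult_var:
  "(var i * var j :: 'k::field mpoly) =
     Poly_Mapping.single (Poly_Mapping.single i 1 + Poly_Mapping.single j 1) 1"
  by (simp add: var_def mult_single)

lemma single_add_single_eq_iff:
  "Poly_Mapping.single a (1::nat) + Poly_Mapping.single b 1 = Poly_Mapping.single c 1 + Poly_Mapping.single d 1
     \<longleftrightarrow> a = c \<and> b = d \<or> a = d \<and> b = c" (is "?l = ?r \<longleftrightarrow> _")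
proof
  assume eq: "?l = ?r"
  have *: "(if a = x then 1 else 0) + (if b = x then 1 else 0) =
      (if c = x then 1 else 0) + (if d = x then 1 else (0::nat))" for x
    using arg_cong[OF eq, of "\<lambda>m. Poly_Mapping.lookup m x"]
    unfolding lookup_add lookup_single when_def .
  show "a = c \<and> b = d \<or> a = d \<and> b = c"
  proof -
    have "c = a \<or> d = a" using *[of a] by (simp split: if_splits)
    then show ?thesis using *[of b] by (elim disjE) (simp_all split: if_splits)
  qed
qed (auto simp: add.commute)

lemma lookup_const_mult: "Poly_Mapping.lookup (const c * p) m = c * Poly_Mapping.lookup p m"
  by (simp add: map.rep_eq when_def flip: mult_map_scale_conv_mult)

lemma subst_hankel_minor:
  "subst f (hankel_minor i j) = f i * f (j + 1) - f j * f (i + 1)"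
  by (simp add: hankel_minor_def subst.insertion_diff subst.insertion_mult)

lemma form_hankel_minor: "form 2 (hankel_minor i j)"
proof -
  have "form 1 (var i)" for i
    by (simp add: form_def var_def mdeg_def)
  from form_mult[OF this this] show ?thesis
    unfolding hankel_minor_def numeral_2_eq_2 by (intro form_diff) auto
qed

text \<open>The kernels of these substitutions are the primes that bound heights from above: the
  variables from \<open>z\<close> to \<open>a - 1\<close> are killed, and from \<open>a\<close> on the column of the Hankel
  matrix with index \<open>j\<close> has the ratio \<open>var (\<tau> j)\<close>.\<close>

definition curve :: "nat \<Rightarrow> nat \<Rightarrow> (nat \<Rightarrow> nat) \<Rightarrow> nat \<Rightarrow> 'k::field mpoly" where
  "curve z a \<tau> i =
     (if i < z then var i else if i < a then 0 else var a * (\<Prod>j\<in>{a..<i}. var (\<tau> j)))"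

lemma curve_Suc: "z \<le> a \<Longrightarrow> a \<le> i \<Longrightarrow> curve z a \<tau> (i + 1) = curve z a \<tau> i * var (\<tau> i)"
  by (simp add: curve_def atLeastLessThanSuc mult_ac)

locale parent_function =
  fixes n :: nat and p :: "nat \<Rightarrow> nat"
  assumes n_pos: "1 \<le> n"
    and p_pos: "2 \<le> j \<Longrightarrow> j \<le> n \<Longrightarrow> 1 \<le> p j"
    and p_less: "2 \<le> j \<Longrightarrow> j \<le> n \<Longrightarrow> p j < j"
    and p_mono: "2 \<le> i \<Longrightarrow> i \<le> j \<Longrightarrow> j \<le> n \<Longrightarrow> p i \<le> p j"
begin

section \<open>The minors of the tree edges as independent quadrics\<close>

definition minors :: "'k::field mpoly set" where
  "minors = (\<lambda>j. hankel_minor (p j) j) ` {2..n}"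

lemma minors_polys: "(minors :: 'k::field mpoly set) \<subseteq> polys {1..n + 1}"
proof -
  have "(hankel_minor (p j) j :: 'k mpoly) \<in> polys {1..n + 1}" if "j \<in> {2..n}" for j
    using that p_pos[of j] p_less[of j] unfolding hankel_minor_def
    by (intro polys_diff polys_mult) auto
  then show ?thesis unfolding minors_def by blast
qed

text \<open>The monomial x_{p(j)} x_{j+1} serves as a marker of the minor of \<open>j\<close>. The
  only clash that \<open>p j < j\<close> does not exclude at once is with the second monomial of the
  minor for k = j + 1, which would need p(k) + 1 = p(j) and contradicts monotonicity. Injectivity
  and independence both follow by reading off this coefficient.\<close>

lemma lookup_minor:
  assumes "j \<in> {2..n}" "k \<in> {2..n}"
  shows "Poly_Mapping.lookup (hankel_minor (p k) k :: 'k::field mpoly)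
      (Poly_Mapping.single (p j) 1 + Poly_Mapping.single (j + 1) 1) = (if j = k then 1 else 0)"
proof -
  have "p k < k" "p j < j" using assms p_less by auto
  moreover have "k = j + 1 \<Longrightarrow> p j \<le> p k" using assms p_mono by auto
  ultimately show ?thesis
    by (auto simp: hankel_minor_def var_mult_var lookup_minus lookup_single when_def
        single_add_single_eq_iff simp del: One_nat_def)
qed

lemma inj_minors: "inj_on (\<lambda>j. hankel_minor (p j) j :: 'k::field mpoly) {2..n}"
proof (rule inj_onI)
  fix j k assume jk: "j \<in> {2..n}" "k \<in> {2..n}"
    "hankel_minor (p j) j = (hankel_minor (p k) k :: 'k mpoly)"
  show "j = k"
    using lookup_minor[OF jk(1,1), where 'k = 'k] lookup_minor[OF jk(1,2), where 'k = 'k] jk(3)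
    by (auto split: if_splits)
qed

lemma card_minors: "card (minors :: 'k::field mpoly set) = n - 1"
  unfolding minors_def by (simp add: card_image[OF inj_minors])

lemma independent_minors: "mpoly.independent (minors :: 'k::field mpoly set)"
  unfolding mpoly.dependent_explicit
proof
  assume "\<exists>t u. finite t \<and> t \<subseteq> minors \<and> (\<Sum>v\<in>t. const (u v) * v) = (0 :: 'k mpoly) \<and> (\<exists>v\<in>t. u v \<noteq> 0)"
  then obtain t u v where t: "finite t" "t \<subseteq> minors" "(\<Sum>v\<in>t. const (u v) * v) = (0 :: 'k mpoly)"
    "v \<in> t" "u v \<noteq> 0"
    by blast
  then obtain j where j: "j \<in> {2..n}" "v = hankel_minor (p j) j" unfolding minors_def by blast
  let ?m = "Poly_Mapping.single (p j) 1 + Poly_Mapping.single (j + 1) (1::nat)"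
  have *: "Poly_Mapping.lookup w ?m = (if w = v then 1 else 0)" if w: "w \<in> t" for w
  proof -
    obtain k where k: "k \<in> {2..n}" "w = hankel_minor (p k) k" using w t(2) unfolding minors_def by blast
    have "w = v \<longleftrightarrow> k = j" using inj_minors k j by (auto dest: inj_onD)
    then show ?thesis using lookup_minor[OF j(1) k(1), where 'k = 'k] k(2) by auto
  qed
  have "0 = Poly_Mapping.lookup (\<Sum>w\<in>t. const (u w) * w) ?m" using t(3) by simp
  also have "\<dots> = (\<Sum>w\<in>t. if w = v then u w else 0)"
    unfolding lookup_sum lookup_const_mult by (intro sum.cong refl) (simp add: * del: One_nat_def)
  also have "\<dots> = u v" using t(1,4) by simp
  finally show False using t(5) by simp
qed

abbreviation hankel_ideal :: "'k::field mpoly set" where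
  "hankel_ideal \<equiv> Idl\<^bsub>mpoly_ring {1..n + 1}\<^esub> minors"

lemma num_generators_minors:
  "num_generators (mpoly_ring {1..n + 1}) (hankel_ideal :: 'k::field mpoly set) = n - 1"
proof -
  have "num_generators (mpoly_ring {1..n + 1}) (hankel_ideal :: 'k mpoly set) = card (minors :: 'k mpoly set)"
    by (rule num_generators_forms[OF _ minors_polys _ independent_minors, where d = 2])
      (auto simp: minors_def form_hankel_minor)
  then show ?thesis by (simp only: card_minors)
qed

section \<open>Upper bounds for the height\<close>

lemma kernel_height_le:
  fixes f :: "nat \<Rightarrow> 'k::field mpoly"
  assumes f: "\<And>j. j \<in> {2..n} \<Longrightarrow> subst f (hankel_minor (p j) j) = 0"
    and v: "\<And>i. i < d \<Longrightarrow> v i \<in> {1..n + 1}" and ind: "alg_indep {0} (\<lambda>i. f (v i)) d"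
  shows "ideal_height (mpoly_ring {1..n + 1}) (hankel_ideal :: 'k mpoly set) \<le> enat (n + 1 - d)"
proof -
  let ?R = "mpoly_ring {1..n + 1} :: 'k mpoly ring"
  let ?P = "{q \<in> polys {1..n + 1}. subst f q = 0}"
  have prime: "primeideal ?P ?R" by (rule subst_kernel_prime)
  have "minors \<subseteq> ?P" using minors_polys f by (auto simp: minors_def)
  then have "hankel_ideal \<subseteq> ?P"
    by (rule genideal_mpoly(3)[OF minors_polys primeideal.axioms(1)[OF prime]])
  then have "ideal_height ?R hankel_ideal \<le> prime_height ?R ?P"
    unfolding ideal_height_def using prime by (intro INF_lower) simp
  also have "\<dots> \<le> enat (card {1..n + 1} - d)"
    by (rule subst_kernel_height_le) (use v ind in auto)
  finally show ?thesis by simp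
qed

text \<open>Either the columns \<open>p j\<close> and \<open>j\<close> are proportional with the
  same ratio, or both monomials vanish separately: one through the factor
  \<open>var (p j + 1)\<close>, the other through \<open>var (p j)\<close> or
  \<open>var (j + 1)\<close>.\<close>

lemma curve_kills_minor:
  assumes "j \<in> {2..n}" "z \<le> a"
    and "a \<le> p j \<and> \<tau> (p j) = \<tau> j \<or>
      (z \<le> p j \<and> p j < a \<or> z \<le> j + 1 \<and> j + 1 < a) \<and> z \<le> p j + 1 \<and> p j + 1 < a"
  shows "subst (curve z a \<tau>) (hankel_minor (p j) j) = 0"
proof -
  have zero: "curve z a \<tau> i = 0" if "z \<le> i" "i < a" for i using that by (simp add: curve_def)
  have "p j < j" using assms(1) p_less by simp
  then show ?thesis
    using assms(2,3) by (auto simp: subst_hankel_minor zero curve_Suc[simplified])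
qed

lemma alg_indep_trivial: "alg_indep {0 :: 'k::field mpoly} f 0"
  by (rule alg_indep_0) auto

lemma height_le_n: "ideal_height (mpoly_ring {1..n + 1}) (hankel_ideal :: 'k::field mpoly set) \<le> enat (n - 1)"
proof -
  \<comment> \<open>With \<open>z = a = 1\<close> no variable is killed, and \<open>var i\<close>
    goes to \<open>var 1 * var 2 ^ (i - 1)\<close> for positive \<open>i\<close>. All columns share
    the ratio \<open>var 2\<close>, so every minor vanishes, whatever the tree is.\<close>
  let ?f = "curve 1 1 (\<lambda>_. 2) :: nat \<Rightarrow> 'k mpoly"
  have f: "?f (Suc 0) = 1 * var 1" "?f (Suc (Suc 0)) = var 1 * var 2"
    by (simp_all add: curve_def)
  have "alg_indep {0} (\<lambda>i. ?f (Suc i)) 1"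
    using alg_indep_triangular[OF alg_indep_trivial, of "\<lambda>i. ?f (Suc i)" 1 1] f by simp
  then have "alg_indep {0} (\<lambda>i. ?f (Suc i)) (Suc 1)"
    by (rule alg_indep_triangular[where w = 2 and t = "var 1"]) (use f in auto)
  then have "ideal_height (mpoly_ring {1..n + 1}) (hankel_ideal :: 'k mpoly set) \<le> enat (n + 1 - 2)"
    using n_pos p_pos by (intro kernel_height_le[where f = ?f and v = Suc] curve_kills_minor)
      (auto simp: numeral_2_eq_2)
  then show ?thesis by simp
qed

text \<open>The colour marks the descendants of \<open>a\<close>. In the forest on the vertices from
  \<open>a\<close> on, every vertex has at most one parent, so this set is closed in both directions
  along the edges; \<open>a + 1\<close> has its parent below \<open>a\<close> and is a root of that
  forest.\<close>

lemma component_colouring: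
  assumes a: "a + 1 \<le> n" "2 \<le> a" and roots: "p (a + 1) < a"
  shows "\<exists>c. c a \<and> \<not> c (a + 1) \<and> (\<forall>j\<in>{2..n}. a \<le> p j \<longrightarrow> c (p j) = c j)"
proof -
  define E where "E = {(p j, j) | j. j \<in> {2..n} \<and> a \<le> p j}"
  define c where "c j \<longleftrightarrow> (a, j) \<in> E\<^sup>*" for j
  have "c j" if "j \<in> {2..n}" "a \<le> p j" "c (p j)" for j
    unfolding c_def by (rule rtrancl_into_rtrancl[of a "p j"]) (use that in \<open>auto simp: c_def E_def\<close>)
  moreover have "c (p j)" if j: "j \<in> {2..n}" "a \<le> p j" "c j" for j
  proof -
    have "a \<noteq> j" using j p_less[of j] by auto
    with j(3) obtain i where "(a, i) \<in> E\<^sup>*" "(i, j) \<in> E" unfolding c_def by (auto elim: rtranclE)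
    then show ?thesis unfolding c_def E_def by auto
  qed
  moreover have "\<not> c (a + 1)"
  proof
    assume "c (a + 1)"
    then obtain i where "(i, a + 1) \<in> E" unfolding c_def by (auto elim: rtranclE)
    then show False using roots unfolding E_def by auto
  qed
  moreover have "c a" by (simp add: c_def)
  ultimately show ?thesis by blast
qed

text \<open>Here three components remain after the vertices up to \<open>k\<close> are removed.  If \<open>k\<close> is maximal,
  then \<open>k + 1\<close> is an isolated vertex of the remaining forest, its column is \<open>(0, var (k + 2))\<close>, and
  the other two components get ratios of their own.\<close>

lemma height_less_three_components:
  assumes "1 \<le> k" "k + 3 \<le> n" "p (k + 3) \<le> k"
  shows "ideal_height (mpoly_ring {1..n + 1}) (hankel_ideal :: 'k::field mpoly set) \<le> enat (n - 2)"
proof -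
  define Q where "Q k \<longleftrightarrow> 1 \<le> k \<and> k + 3 \<le> n \<and> p (k + 3) \<le> k" for k
  define m where "m = Greatest Q"
  have Qb: "Q y \<Longrightarrow> y \<le> n" for y by (simp add: Q_def)
  have "Q k" using assms by (simp add: Q_def)
  then have Qm: "Q m" unfolding m_def by (rule GreatestI_nat) (use Qb in auto)
  have max: "Q y \<Longrightarrow> y \<le> m" for y unfolding m_def by (rule Greatest_le_nat) (use Qb in auto)
  \<comment> \<open>As \<open>p (m + 3) \<le> m\<close>, a child \<open>j\<close> of
    \<open>m + 1\<close> comes after \<open>m + 3\<close>. Monotonicity then bounds
    \<open>p (m + 4)\<close> by \<open>m + 1\<close>, so \<open>Q (m + 1)\<close> holds against the
    maximality of \<open>m\<close>.\<close>
  have no_child: "p j \<noteq> m + 1" if "j \<in> {2..n}" for j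
  proof
    assume j: "p j = m + 1"
    have "\<not> j \<le> m + 3" using p_mono[of j "m + 3"] that j Qm by (auto simp: Q_def)
    then have "Q (m + 1)" using p_mono[of "m + 4" j] that j by (auto simp: Q_def numeral_eq_Suc)
    then show False using max by fastforce
  qed
  define a where "a = m + 2"
  have a: "a + 1 \<le> n" "3 \<le> a" using Qm by (auto simp: Q_def a_def)
  have "p (a + 1) < a" using Qm by (auto simp: Q_def a_def numeral_eq_Suc)
  then obtain c where c: "c a" "\<not> c (a + 1)" "\<forall>j\<in>{2..n}. a \<le> p j \<longrightarrow> c (p j) = c j"
    using component_colouring[of a] a by auto
  \<comment> \<open>The two ratios are named \<open>a + 1\<close> and \<open>a + 2\<close> so that
    the images of \<open>var a\<close>, \<open>var (a + 1)\<close> and \<open>var (a + 2)\<close>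
    bring in one new variable each. All components other than that of \<open>a\<close> may share the
    second ratio.\<close>
  define \<tau> where "\<tau> j = (if c j then a + 1 else a + 2)" for j
  let ?f = "curve 1 a \<tau> :: nat \<Rightarrow> 'k mpoly"
  have f: "?f a = 1 * var a" "?f (a + 1) = var a * var (a + 1)"
      "?f (a + 2) = (var a * var (a + 1)) * var (a + 2)"
    using a c(1,2) by (simp_all add: curve_def \<tau>_def)
  have i1: "alg_indep {0} (\<lambda>i. ?f (a + i)) 1"
    using alg_indep_triangular[OF alg_indep_trivial, of "\<lambda>i. ?f (a + i)" a 1] f by simp
  have i2: "alg_indep {0} (\<lambda>i. ?f (a + i)) (Suc 1)"
    by (rule alg_indep_triangular[OF i1, where w = "a + 1" and t = "var a"]) (use f in auto)
  have i3: "alg_indep {0} (\<lambda>i. ?f (a + i)) (Suc (Suc 1))"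
    by (rule alg_indep_triangular[OF i2, where w = "a + 2" and t = "var a * var (a + 1)"])
      (use f in \<open>auto simp: less_Suc_eq numeral_2_eq_2 intro!: polys_mult\<close>)
  have kill: "subst ?f (hankel_minor (p j) j) = 0" if j: "j \<in> {2..n}" for j
  proof (rule curve_kills_minor[OF j])
    show "a \<le> p j \<and> \<tau> (p j) = \<tau> j \<or>
      (1 \<le> p j \<and> p j < a \<or> 1 \<le> j + 1 \<and> j + 1 < a) \<and> 1 \<le> p j + 1 \<and> p j + 1 < a"
    proof (cases "a \<le> p j")
      case True
      then show ?thesis using c(3) j by (auto simp: \<tau>_def)
    next
      case False
      then show ?thesis using no_child[OF j] p_pos[of j] j by (auto simp: a_def)
    qed
  qed (use a in auto)
  have "ideal_height (mpoly_ring {1..n + 1}) (hankel_ideal :: 'k mpoly set) \<le> enat (n + 1 - Suc (Suc 1))"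
    using a by (intro kernel_height_le[OF kill _ i3]) auto
  then show ?thesis by (simp add: numeral_2_eq_2)
qed

text \<open>Here only two components remain, but the children of the root are among the removed
  vertices, so \<open>var 1\<close> need not be killed and is the third independent element.\<close>

lemma height_less_two_components:
  assumes "2 \<le> k" "k + 2 \<le> n" "p (k + 2) \<le> k" "2 \<le> p (k + 1)"
  shows "ideal_height (mpoly_ring {1..n + 1}) (hankel_ideal :: 'k::field mpoly set) \<le> enat (n - 2)"
proof -
  define Q where "Q k \<longleftrightarrow> 2 \<le> k \<and> k + 2 \<le> n \<and> p (k + 2) \<le> k \<and> 2 \<le> p (k + 1)" for k
  define m where "m = Greatest Q"
  have Qb: "Q y \<Longrightarrow> y \<le> n" for y by (simp add: Q_def)
  have "Q k" using assms by (simp add: Q_def)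
  then have Qm: "Q m" unfolding m_def by (rule GreatestI_nat) (use Qb in auto)
  have max: "Q y \<Longrightarrow> y \<le> m" for y unfolding m_def by (rule Greatest_le_nat) (use Qb in auto)
  have no_child: "p j \<noteq> m + 1" if "j \<in> {2..n}" for j
  proof
    assume j: "p j = m + 1"
    \<comment> \<open>Maximality is used as for three components. The additional requirement
      \<open>2 \<le> p (m + 2)\<close> is inherited from \<open>2 \<le> p (m + 1)\<close> by
      monotonicity.\<close>
    have "\<not> j \<le> m + 2" using p_mono[of j "m + 2"] that j Qm by (auto simp: Q_def)
    moreover have "p (m + 1) \<le> p (m + 2)" using Qm by (intro p_mono) (auto simp: Q_def)
    ultimately have "Q (m + 1)" using p_mono[of "m + 3" j] that j Qm by (auto simp: Q_def numeral_eq_Suc)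
    then show False using max by fastforce
  qed
  define a where "a = m + 2"
  have a: "a \<le> n" "4 \<le> a" using Qm by (auto simp: Q_def a_def)
  let ?f = "curve 2 a (\<lambda>_. a + 1) :: nat \<Rightarrow> 'k mpoly"
  \<comment> \<open>The three independent variables are those with indices 1, \<open>a\<close> and
    \<open>a + 1\<close>. The last index also names the common ratio, so \<open>var (a + 1)\<close>
    goes to \<open>var a * var (a + 1)\<close>.\<close>
  let ?v = "\<lambda>i. if i = 0 then 1 else a + i - 1"
  have f: "?f 1 = 1 * var 1" "?f a = 1 * var a" "?f (a + 1) = var a * var (a + 1)"
    using a by (simp_all add: curve_def)
  have i1: "alg_indep {0} (\<lambda>i. ?f (?v i)) 1"
    using alg_indep_triangular[OF alg_indep_trivial, of "\<lambda>i. ?f (?v i)" 1 1] f by simp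
  have i2: "alg_indep {0} (\<lambda>i. ?f (?v i)) (Suc 1)"
    by (rule alg_indep_triangular[OF i1, where w = a and t = 1]) (use f a in auto)
  have i3: "alg_indep {0} (\<lambda>i. ?f (?v i)) (Suc (Suc 1))"
    by (rule alg_indep_triangular[OF i2, where w = "a + 1" and t = "var a"])
      (use f a in \<open>auto simp: less_Suc_eq\<close>)
  have kill: "subst ?f (hankel_minor (p j) j) = 0" if j: "j \<in> {2..n}" for j
  proof (rule curve_kills_minor[OF j])
    show "a \<le> p j \<and> a + 1 = a + 1 \<or>
      (2 \<le> p j \<and> p j < a \<or> 2 \<le> j + 1 \<and> j + 1 < a) \<and> 2 \<le> p j + 1 \<and> p j + 1 < a"
    proof (cases "p j = 1")
      case True
      \<comment> \<open>Since \<open>2 \<le> p (m + 1)\<close>, a child \<open>j\<close> of the root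
        is at most \<open>m\<close>. Thus \<open>var 2\<close> and \<open>var (j + 1)\<close> are
        both killed, and the minor vanishes although \<open>var 1\<close> survives.\<close>
      have "\<not> m + 1 \<le> j" using p_mono[of "m + 1" j] True j Qm by (auto simp: Q_def)
      then show ?thesis using True j a by (auto simp: a_def)
    next
      case False
      then show ?thesis using no_child[OF j] p_pos[of j] j by (auto simp: a_def)
    qed
  qed (use a in auto)
  have "ideal_height (mpoly_ring {1..n + 1}) (hankel_ideal :: 'k mpoly set) \<le> enat (n + 1 - Suc (Suc 1))"
    using a by (intro kernel_height_le[OF kill _ i3]) auto
  then show ?thesis by (simp add: numeral_2_eq_2)
qed

text \<open>The parent functions of the paths rooted at a leaf (first disjunct) and of those rooted at
  the neighbor of a leaf, which is the vertex 2 if \<open>p 4 = 3\<close> and the vertex 3 if \<open>p 4 = 2\<close>.\<close>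

definition ci_pattern :: bool where
  "ci_pattern \<longleftrightarrow> (\<forall>j\<in>{3..n}. p j = j - 1) \<or>
     3 \<le> n \<and> p 3 = 1 \<and> (4 \<le> n \<longrightarrow> p 4 \<in> {2, 3}) \<and> (\<forall>j\<in>{5..n}. p j = j - 1)"

lemma p_2: "2 \<le> n \<Longrightarrow> p 2 = 1"
  using p_pos[of 2] p_less[of 2] by auto

text \<open>If both component lemmas fail to apply, then from 4 on the parent of \<open>j\<close> is
  \<open>j - 1\<close>, or it is \<open>j - 2\<close> and \<open>j - 1\<close> is a child of the
  root; only the two patterns satisfy this. The bound \<open>3 \<le> n\<close> is recorded because
  of truncated subtraction: for n = 1 the numbers \<open>n - 2\<close> and \<open>n - 1\<close>
  coincide.\<close>

lemma not_ci_pattern_height: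
  assumes "\<not> ci_pattern"
  shows "3 \<le> n"
    "ideal_height (mpoly_ring {1..n + 1}) (hankel_ideal :: 'k::field mpoly set) \<le> enat (n - 2)"
proof -
  show n: "3 \<le> n" using assms unfolding ci_pattern_def by force
  show "ideal_height (mpoly_ring {1..n + 1}) (hankel_ideal :: 'k::field mpoly set) \<le> enat (n - 2)"
  proof (rule ccontr)
    assume neg: "\<not> ?thesis"
    have A: "k < p (k + 3)" if "1 \<le> k" "k + 3 \<le> n" for k
      using neg height_less_three_components[of k] that by (meson not_le)
    have B: "k < p (k + 2) \<or> p (k + 1) < 2" if "2 \<le> k" "k + 2 \<le> n" for k
      using neg height_less_two_components[of k] that by (meson not_le)
    have ge: "p j = j - 1 \<or> p j = j - 2 \<and> p (j - 1) = 1" if j: "4 \<le> j" "j \<le> n" for j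
    proof -
      obtain m where m: "j = m + 4" using j(1) by (metis add.commute le_Suc_ex)
      show ?thesis
        using A[of "m + 1"] B[of "m + 2"] p_less[of "m + 4"] p_pos[of "m + 3"] j(2) unfolding m
        by (auto simp: numeral_eq_Suc)
    qed
    \<comment> \<open>From 5 on, the parent of \<open>j - 1\<close> is at least
      \<open>j - 3\<close>, hence at least 2, so the exceptional alternative of \<open>ge\<close> is
      impossible.\<close>
    have five: "p j = j - 1" if j: "5 \<le> j" "j \<le> n" for j
    proof -
      have "p (j - 1) = j - 1 - 1 \<or> p (j - 1) = j - 1 - 2 \<and> p (j - 1 - 1) = 1"
        using j by (intro ge) auto
      then have "p (j - 1) \<noteq> 1" using j by arith
      then show ?thesis using ge[of j] j by auto
    qed
    have "p 3 = 1 \<or> p 3 = 2" using p_pos[of 3] p_less[of 3] n by auto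
    moreover have "p 4 = 3 \<or> p 4 = 2 \<and> p 3 = 1" if "4 \<le> n" using ge[of 4] that by simp
    moreover have "j = 3 \<or> j = 4 \<or> 5 \<le> j" if "j \<in> {3..n}" for j using that by auto
    ultimately have ci_pattern
      unfolding ci_pattern_def using n five by (cases "p 3 = 1") fastforce+
    then show False using assms by blast
  qed
qed

section \<open>The lower bound for the two path patterns\<close>

lemma dichotomy_along_path:
  fixes Q :: "nat \<Rightarrow> bool"
  assumes "\<And>i. a \<le> i \<Longrightarrow> i + 1 \<le> n \<Longrightarrow> Q (i + 1) \<longleftrightarrow> Q i \<or> Q (i + 2)"
  shows "(\<forall>i\<in>{a..n + 1}. \<not> Q i) \<or> (\<forall>i\<in>{a + 1..n}. Q i)"
proof (cases "\<forall>i\<in>{a..n + 1}. \<not> Q i")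
  case False
  then obtain i where i: "a \<le> i" "i \<le> n + 1" "Q i" by auto
  \<comment> \<open>On a path the relation is x_i x_{i+2} = x_{i+1}^2, so one vanishing variable
    makes its neighbors vanish in both directions. The spread stops before the end variables
    \<open>a\<close> and \<open>n + 1\<close>, since neither is the middle variable of a
    relation.\<close>
  have up: "Q j" if "i \<le> j" "j \<le> n" for j
    using that
  proof (induction rule: dec_induct)
    case (step j)
    then show ?case using assms[of j] i(1) by auto
  qed (use i in simp)
  have down: "Q j" if "j \<le> i" "a + 1 \<le> j" for j
    using that
  proof (induction rule: inc_induct)
    case (step j)
    then show ?case using assms[of "j - 1"] i by (cases j) auto
  qed (use i in simp)
  have "Q j" if "j \<in> {a + 1..n}" for j
    using up[of j] down[of j] that by (cases "i \<le> j") auto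
  then show ?thesis by blast
qed simp

text \<open>Only the set \<open>Q\<close> of the variables that lie in a prime matters: \<open>var (j + 1)\<close> is algebraic
  over the preceding variables as soon as it is in \<open>Q\<close> or \<open>var (p j)\<close> is not.\<close>

lemma ci_pattern_exceptions:
  fixes Q :: "nat \<Rightarrow> bool"
  assumes ci: ci_pattern
    and H: "\<And>j. j \<in> {2..n} \<Longrightarrow> Q (p j) \<or> Q (j + 1) \<longleftrightarrow> Q j \<or> Q (p j + 1)"
  shows "\<exists>x y. \<forall>b\<in>{1..n + 1}. b = x \<or> b = y \<or> Q b \<or> 3 \<le> b \<and> \<not> Q (p (b - 1))"
  using ci[unfolded ci_pattern_def]
proof
  assume p: "\<forall>j\<in>{3..n}. p j = j - 1"
  have p': "p j = j - 1" if "2 \<le> j" "j \<le> n" for j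
    using p p_2 that by (cases "j = 2") auto
  have "(\<forall>i\<in>{1..n + 1}. \<not> Q i) \<or> (\<forall>i\<in>{1 + 1..n}. Q i)"
  proof (rule dichotomy_along_path)
    fix i assume "1 \<le> i" "i + 1 \<le> n"
    then show "Q (i + 1) \<longleftrightarrow> Q i \<or> Q (i + 2)" using H[of "i + 1"] p'[of "i + 1"] by auto
  qed
  then show ?thesis
  proof
    assume "\<forall>i\<in>{1..n + 1}. \<not> Q i"
    moreover have "p (b - 1) \<in> {1..n + 1}" if "3 \<le> b" "b \<le> n + 1" for b
      using p'[of "b - 1"] that by auto
    moreover have "b = 1 \<or> b = 2 \<or> 3 \<le> b" if "1 \<le> b" for b :: nat using that by auto
    ultimately have "\<forall>b\<in>{1..n + 1}. b = 1 \<or> b = 2 \<or> 3 \<le> b \<and> \<not> Q (p (b - 1))"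
      by (meson atLeastAtMost_iff)
    then show ?thesis by blast
  next
    assume "\<forall>i\<in>{1 + 1..n}. Q i"
    then have "\<forall>b\<in>{1..n + 1}. b = 1 \<or> b = n + 1 \<or> Q b" by auto
    then show ?thesis by blast
  qed
next
  assume *: "3 \<le> n \<and> p 3 = 1 \<and> (4 \<le> n \<longrightarrow> p 4 \<in> {2, 3}) \<and> (\<forall>j\<in>{5..n}. p j = j - 1)"
  then have n: "3 \<le> n" and p3: "p 3 = 1" and p4: "4 \<le> n \<Longrightarrow> p 4 = 2 \<or> p 4 = 3"
    and p5: "\<And>j. 5 \<le> j \<Longrightarrow> j \<le> n \<Longrightarrow> p j = j - 1" by auto
  have H2: "Q 1 \<or> Q 3 \<longleftrightarrow> Q 2" using H[of 2] p_2 n by (auto simp: numeral_eq_Suc)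
  have H3: "Q 1 \<or> Q 4 \<longleftrightarrow> Q 3 \<or> Q 2" using H[of 3] p3 n by (auto simp: numeral_eq_Suc)
  have H42: "Q 2 \<or> Q 5 \<longleftrightarrow> Q 4 \<or> Q 3" if "p 4 = 2" "4 \<le> n"
    using H[of 4] that by (auto simp: numeral_eq_Suc)
  have H43: "Q 3 \<or> Q 5 \<longleftrightarrow> Q 4" if "p 4 = 3" "4 \<le> n"
    using H[of 4] that by (auto simp: numeral_eq_Suc)
  have chain4: "(\<forall>i\<in>{4..n + 1}. \<not> Q i) \<or> (\<forall>i\<in>{4 + 1..n}. Q i)"
  proof (rule dichotomy_along_path)
    fix i assume "4 \<le> i" "i + 1 \<le> n"
    then show "Q (i + 1) \<longleftrightarrow> Q i \<or> Q (i + 2)" using H[of "i + 1"] p5[of "i + 1"] by auto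
  qed
  have pb: "p (b - 1) = b - 2" if "6 \<le> b" "b \<le> n + 1" for b
    using p5[of "b - 1"] that by auto
  have small: "b = 1 \<or> b = 2 \<or> b = 3 \<or> b = 4 \<or> b = 5 \<or> 6 \<le> b" if "1 \<le> b" for b :: nat
    using that by auto
  \<comment> \<open>If x_1 does not vanish, x_2 decides: its vanishing forces that of x_3 and x_4
    through the two edges at the root, and otherwise no variable vanishes. If x_1 vanishes, so does
    x_2, and the edge from 1 to 3 imposes nothing further; the position of vertex 4 then
    matters.\<close>
  consider "Q 1" "p 4 = 3 \<or> n = 3" | "Q 1" "p 4 = 2" "4 \<le> n" | "\<not> Q 1" "Q 2" | "\<not> Q 1" "\<not> Q 2"
    using p4 n by fastforce
  then show ?thesis
  proof cases
    case 1
    have "(\<forall>i\<in>{3..n + 1}. \<not> Q i) \<or> (\<forall>i\<in>{3 + 1..n}. Q i)"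
    proof (rule dichotomy_along_path)
      fix i assume i: "3 \<le> i" "i + 1 \<le> n"
      then have "i + 1 = 4 \<or> 5 \<le> i + 1" by auto
      then have "p (i + 1) = i" using i p5[of "i + 1"] 1(2) by auto
      then show "Q (i + 1) \<longleftrightarrow> Q i \<or> Q (i + 2)" using H[of "i + 1"] i by auto
    qed
    then show ?thesis
    proof
      assume none: "\<forall>i\<in>{3..n + 1}. \<not> Q i"
      have "b = 3 \<or> b = 4 \<or> Q b \<or> 3 \<le> b \<and> \<not> Q (p (b - 1))" if b: "b \<in> {1..n + 1}" for b
      proof -
        have "p (b - 1) \<in> {3..n + 1}" if "5 \<le> b"
          using that b pb[of b] 1(2) by (cases "b = 5") auto
        then show ?thesis using small[of b] b 1(1) H2 none by auto
      qed
      then show ?thesis by blast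
    next
      assume "\<forall>i\<in>{3 + 1..n}. Q i"
      then have "b = 3 \<or> b = n + 1 \<or> Q b" if b: "b \<in> {1..n + 1}" for b
        using b 1(1) H2 by (cases "b \<le> 3"; cases "b = 1"; cases "b = 2"; cases "b = n + 1") auto
      then show ?thesis by blast
    qed
  next
    case 2
    have H34: "Q 4 \<or> Q 3" using H42 2 H2 by auto
    from chain4 show ?thesis
    proof
      assume none: "\<forall>i\<in>{4..n + 1}. \<not> Q i"
      then have "Q 3" using H34 n by auto
      have "b = 4 \<or> b = 5 \<or> Q b \<or> 3 \<le> b \<and> \<not> Q (p (b - 1))" if b: "b \<in> {1..n + 1}" for b
      proof -
        have "b - 2 \<in> {4..n + 1}" if "6 \<le> b" using b that by auto
        then have "\<not> Q (b - 2)" if "6 \<le> b" using none that by blast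
        then show ?thesis using small[of b] b 2(1) H2 pb[of b] \<open>Q 3\<close> by auto
      qed
      then show ?thesis by blast
    next
      assume many: "\<forall>i\<in>{4 + 1..n}. Q i"
      \<comment> \<open>By \<open>H34\<close> at least one of x_3 and x_4 vanishes, so only one of
        them counts as an exception beside the end variable.\<close>
      have "b = (if Q 4 then 3 else 4) \<or> b = n + 1 \<or> Q b" if b: "b \<in> {1..n + 1}" for b
      proof -
        have "b = 1 \<or> b = 2 \<or> b = 3 \<or> b = 4 \<or> b = n + 1 \<or> b \<in> {4 + 1..n}" using b by auto
        then show ?thesis using 2(1) H2 many H34 by metis
      qed
      then show ?thesis by blast
    qed
  next
    case 3
    then have Q34: "Q 3" "Q 4" using H2 H3 by auto
    then have "\<forall>i\<in>{4 + 1..n}. Q i" using chain4 n by auto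
    then have "b = 1 \<or> b = n + 1 \<or> Q b" if b: "b \<in> {1..n + 1}" for b
    proof -
      have "b = 1 \<or> b = 2 \<or> b = 3 \<or> b = 4 \<or> b = n + 1 \<or> b \<in> {4 + 1..n}" using b by auto
      then show ?thesis using \<open>\<forall>i\<in>{4 + 1..n}. Q i\<close> 3 Q34 by blast
    qed
    then show ?thesis by blast
  next
    case 4
    then have Q34: "\<not> Q 3" "\<not> Q 4" using H2 H3 by auto
    have Q5: "\<not> Q 5" if "4 \<le> n" using p4[OF that] H42[OF _ that] H43[OF _ that] Q34 4 by auto
    have none: "\<forall>i\<in>{4..n + 1}. \<not> Q i"
    proof (cases "5 \<le> n")
      case True
      then show ?thesis using chain4 Q5 by auto
    next
      case False
      then have "i = 4 \<or> i = 5 \<and> 4 \<le> n" if "i \<in> {4..n + 1}" for i using that by auto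
      then show ?thesis using Q34 Q5 by metis
    qed
    have none': "\<not> Q i" if "i \<in> {1..n + 1}" for i
    proof -
      have "i = 1 \<or> i = 2 \<or> i = 3 \<or> i \<in> {4..n + 1}" using that by auto
      then show ?thesis using none 4 Q34 by blast
    qed
    have parent: "p (b - 1) \<in> {1..n + 1}" if "3 \<le> b" "b \<le> n + 1" for b
    proof -
      have j: "2 \<le> b - 1" "b - 1 \<le> n" using that by auto
      show ?thesis using p_pos[OF j] p_less[OF j] j by simp
    qed
    have "b = 1 \<or> b = 2 \<or> Q b \<or> 3 \<le> b \<and> \<not> Q (p (b - 1))" if b: "b \<in> {1..n + 1}" for b
    proof -
      have "b = 1 \<or> b = 2 \<or> 3 \<le> b \<and> b \<le> n + 1" using b by auto
      then show ?thesis using none' parent by blast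
    qed
    then show ?thesis by blast
  qed
qed

text \<open>Of the n + 1 variables all but two satisfy a relation as required by
  \<open>prime_height_ge\<close>, for every prime over the ideal; which two are excepted depends on
  the prime.\<close>

lemma ci_pattern_height:
  assumes ci_pattern
  shows "enat (n - 1) \<le> ideal_height (mpoly_ring {1..n + 1}) (hankel_ideal :: 'k::field mpoly set)"
  unfolding ideal_height_def
proof (rule INF_greatest, clarify)
  let ?X = "{1..n + 1}"
  fix P :: "'k mpoly set"
  assume P: "primeideal P (mpoly_ring ?X)" and sub: "hankel_ideal \<subseteq> P"
  define Q where "Q i \<longleftrightarrow> (var i :: 'k mpoly) \<in> P" for i
  define B where "B = {b\<in>?X. Q b \<or> 3 \<le> b \<and> \<not> Q (p (b - 1))}"
  have minor: "var (p j) * var (j + 1) - var j * var (p j + 1) \<in> P" if "j \<in> {2..n}" for j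
  proof -
    have "hankel_minor (p j) j \<in> minors" using that by (simp add: minors_def)
    then show ?thesis using genideal_mpoly(2)[OF minors_polys, where 'k = 'k] sub unfolding hankel_minor_def by blast
  qed
  have prod: "var i * var j \<in> P \<longleftrightarrow> Q i \<or> Q j" if "i \<in> ?X" "j \<in> ?X" for i j
    using that prime_disj[OF P, of "var i" "var j"] prime_lmult[OF P, of "var j" "var i"]
      prime_rmult[OF P, of "var i" "var j"] by (auto simp: Q_def)
  \<comment> \<open>The two monomials of a minor are congruent modulo \<open>P\<close>, so one lies
    in \<open>P\<close> if and only if the other does; primality splits each into its
    factors.\<close>
  have H: "Q (p j) \<or> Q (j + 1) \<longleftrightarrow> Q j \<or> Q (p j + 1)" if j: "j \<in> {2..n}" for j
  proof -
    have "p j \<in> ?X" "j + 1 \<in> ?X" "j \<in> ?X" "p j + 1 \<in> ?X" using j p_pos[of j] p_less[of j] by auto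
    moreover have "var (p j) * var (j + 1) \<in> P \<longleftrightarrow> var j * var (p j + 1) \<in> P"
      using prime_add_left_iff[OF P, of "var j * var (p j + 1)" "var (p j) * var (j + 1) - var j * var (p j + 1)"]
        prime_add_left_iff[OF P minor[OF j], of "var j * var (p j + 1)"] by (simp add: add.commute)
    ultimately show ?thesis using prod by blast
  qed
  obtain x y where "\<forall>b\<in>?X. b = x \<or> b = y \<or> Q b \<or> 3 \<le> b \<and> \<not> Q (p (b - 1))"
    using ci_pattern_exceptions[OF assms H] by blast
  then have "?X - {x, y} \<subseteq> B" unfolding B_def by blast
  then have "card (?X - {x, y}) \<le> card B" by (intro card_mono) (auto simp: B_def)
  moreover have "card ?X - card {x, y} \<le> card (?X - {x, y})" by (rule diff_card_le_card_Diff) simp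
  moreover have "card {x, y} \<le> 2" by (simp add: card_insert_if)
  ultimately have "n - 1 \<le> card B" by simp
  moreover have "enat (card B) \<le> prime_height (mpoly_ring ?X) P"
  proof (rule prime_height_ge[OF _ _ P])
    show "finite B" "B \<subseteq> ?X" by (auto simp: B_def)
    fix b assume b: "b \<in> B"
    show "\<exists>u\<in>polys (?X \<inter> {..<b}). \<exists>v\<in>polys (?X \<inter> {..<b}). u \<notin> P \<and> u * var b - v \<in> P"
    proof (cases "Q b")
      case True
      then show ?thesis using prime_1[OF P] by (intro bexI[of _ 1] bexI[of _ 0]) (auto simp: Q_def)
    next
      case False
      define j where "j = b - 1"
      have j: "j \<in> {2..n}" "b = j + 1" "\<not> Q (p j)" using b False by (auto simp: B_def j_def)
      have lt: "1 \<le> p j" "p j < j" using p_pos[of j] p_less[of j] j by auto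
      show ?thesis
      proof (intro bexI conjI)
        show "var (p j) \<notin> P" using j(3) by (simp add: Q_def)
        show "var (p j) * var b - var j * var (p j + 1) \<in> P" using minor[OF j(1)] j(2) by simp
        show "var j * var (p j + 1) \<in> polys (?X \<inter> {..<b})"
          using lt j by (intro polys_mult) auto
        show "var (p j) \<in> polys (?X \<inter> {..<b})" using lt j by auto
      qed
    qed
  qed
  ultimately show "enat (n - 1) \<le> prime_height (mpoly_ring ?X) P"
    by (meson enat_ord_simps(1) order_trans)
qed

lemma complete_intersection_iff_ci_pattern:
  "complete_intersection (mpoly_ring {1..n + 1}) (hankel_ideal :: 'k::field mpoly set) \<longleftrightarrow> ci_pattern"
proof
  assume "complete_intersection (mpoly_ring {1..n + 1}) (hankel_ideal :: 'k mpoly set)"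
  then have eq: "ideal_height (mpoly_ring {1..n + 1}) (hankel_ideal :: 'k mpoly set) = enat (n - 1)"
    by (simp add: complete_intersection_def num_generators_minors[simplified])
  show ci_pattern
  proof (rule ccontr)
    assume "\<not> ci_pattern"
    from not_ci_pattern_height(1)[OF this] not_ci_pattern_height(2)[OF this, where 'k = 'k]
    show False using eq by simp
  qed
next
  assume ci_pattern
  from ci_pattern_height[OF this, where 'k = 'k] height_le_n[where 'k = 'k]
  show "complete_intersection (mpoly_ring {1..n + 1}) (hankel_ideal :: 'k mpoly set)"
    by (simp add: complete_intersection_def num_generators_minors[simplified])
qed

end

section \<open>Trees with a rooted labeling\<close>

text \<open>\<open>q k\<close> is the position that was being processed when position
  \<open>k\<close> was appended. Later blocks belong to later stages, whence monotonicity. The bound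
  \<open>q k < i\<close> is carried along to compare old entries with the block of stage
  \<open>i\<close>, whose parent is at position \<open>i\<close>.\<close>

lemma bfs_state_parents:
  assumes "bfs_state G i xs"
  shows "xs \<noteq> [] \<and> distinct xs \<and> i \<le> length xs \<and>
    (\<exists>q. (\<forall>k. 1 \<le> k \<and> k < length xs \<longrightarrow> q k < k \<and> q k < i \<and> (xs ! q k, xs ! k) \<in> parcs G) \<and>
         (\<forall>j k. 1 \<le> j \<and> j \<le> k \<and> k < length xs \<longrightarrow> q j \<le> q k))"
  using assms
proof (induction rule: bfs_state.induct)
  case (root r)
  then show ?case by simp
next
  case (process i xs ys)
  then obtain q where q: "\<And>k. 1 \<le> k \<Longrightarrow> k < length xs \<Longrightarrow> q k < k \<and> q k < i \<and> (xs ! q k, xs ! k) \<in> parcs G"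
    and mono: "\<And>j k. 1 \<le> j \<Longrightarrow> j \<le> k \<Longrightarrow> k < length xs \<Longrightarrow> q j \<le> q k" by blast
  define q' where "q' k = (if k < length xs then q k else i)" for k
  have arc: "(xs ! i, ys ! (k - length xs)) \<in> parcs G" if "length xs \<le> k" "k < length (xs @ ys)" for k
  proof -
    have "ys ! (k - length xs) \<in> set ys" using that by (intro nth_mem) auto
    then show ?thesis using process by simp
  qed
  have "q' k < k \<and> q' k < Suc i \<and> ((xs @ ys) ! q' k, (xs @ ys) ! k) \<in> parcs G"
    if k: "1 \<le> k" "k < length (xs @ ys)" for k
  proof (cases "k < length xs")
    case True
    then show ?thesis using q[OF k(1) True] by (auto simp: q'_def nth_append)
  next
    case False
    then show ?thesis using arc[of k] k process.hyps by (auto simp: q'_def nth_append)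
  qed
  moreover have "q' j \<le> q' k" if "1 \<le> j" "j \<le> k" "k < length (xs @ ys)" for j k
    using that mono[of j k] q[of j] by (auto simp: q'_def intro: less_imp_le)
  moreover have "distinct (xs @ ys)" "xs @ ys \<noteq> []" "Suc i \<le> length (xs @ ys)"
    using process by auto
  ultimately show ?case by (intro conjI exI[of _ q']) blast+
qed

lemma rtrancl_imp_vwalk:
  assumes "(u, v) \<in> F\<^sup>*" "v \<in> V" "F \<subseteq> V \<times> V"
  shows "\<exists>w. vwalk w (with_proj \<lparr>pverts = V, parcs = F\<rparr>) \<and> hd w = u \<and> last w = v"
  using assms(1)
proof (induction rule: converse_rtrancl_induct)
  case base
  then show ?case using assms(2) by (intro exI[of _ "[v]"]) (auto simp: vwalk_def)
next
  case (step x y)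
  then obtain w where w: "vwalk w (with_proj \<lparr>pverts = V, parcs = F\<rparr>)" "hd w = y" "last w = v" by blast
  moreover have "w \<noteq> []" using w(1) by auto
  ultimately show ?case using step(1) assms(3)
    by (intro exI[of _ "x # w"]) (auto intro!: vwalk_consI)
qed

text \<open>An arc outside \<open>F\<close> would close a cycle.\<close>

lemma undirected_acyclic_connected_arcs:
  assumes acyc: "undirected_acyclic T" and sym: "sym (parcs T)"
    and F: "F \<subseteq> parcs T" "F \<subseteq> pverts T \<times> pverts T"
    and arc: "(u, v) \<in> parcs T" "u \<noteq> v" "v \<in> pverts T" and conn: "(u, v) \<in> F\<^sup>*"
  shows "(u, v) \<in> F"
proof (rule ccontr)
  assume no: "(u, v) \<notin> F"
  obtain w0 where w0: "vwalk w0 (with_proj \<lparr>pverts = pverts T, parcs = F\<rparr>)" "hd w0 = u" "last w0 = v"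
    using rtrancl_imp_vwalk[OF conn arc(3) F(2)] by blast
  obtain w where w: "vpath w (with_proj \<lparr>pverts = pverts T, parcs = F\<rparr>)" "hd w = u" "last w = v"
    using vwalk_imp_ex_vpath[OF w0] by blast
  then have "vpath w (with_proj T)" using F(1) by (auto simp: vpath_def vwalk_def)
  moreover have "3 \<le> length w"
  proof (rule ccontr)
    assume "\<not> 3 \<le> length w"
    moreover have "w \<noteq> []" using w(1) by auto
    ultimately consider x where "w = [x]" | x y where "w = [x, y]"
      by (cases w rule: remdups_adj.cases) (auto simp: Suc_le_eq)
    then show False using w arc(2) no by cases (auto simp: vpath_def vwalk_def)
  qed
  moreover have "(last w, hd w) \<in> parcs T" using w(2,3) arc(1) sym by (auto dest: symD)
  ultimately show False using acyc unfolding undirected_acyclic_def by blast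
qed

locale labeled_tree = parent_function n p
  for n :: nat and p :: "nat \<Rightarrow> nat" +
  fixes T :: "'v pair_pre_digraph" and l :: "'v \<Rightarrow> nat" and v :: "nat \<Rightarrow> 'v"
  assumes inj_v: "inj_on v {1..n}"
    and verts_eq: "pverts T = v ` {1..n}"
    and label_v: "j \<in> {1..n} \<Longrightarrow> l (v j) = j"
    and arcs_eq: "parcs T = (\<lambda>j. (v (p j), v j)) ` {2..n} \<union> (\<lambda>j. (v j, v (p j))) ` {2..n}"

text \<open>\<open>F\<close> consists of the arcs along which the search discovered vertices, in
  both directions. It joins all vertices, so an arc of \<open>T\<close> outside \<open>F\<close>
  would close a cycle; hence the parent function describes \<open>T\<close> completely.\<close>

lemma labeled_tree_exists:
  fixes T :: "'v pair_pre_digraph"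
  assumes T: "undirected_tree T" and l: "rooted_labeling T l"
  shows "\<exists>n p v. labeled_tree n p T l v"
proof -
  obtain xs where xs: "bfs_state T (length xs) xs" "set xs = pverts T"
      "\<And>k. k < length xs \<Longrightarrow> l (xs ! k) = k + 1"
    using l unfolding rooted_labeling_def by blast
  obtain q where q: "\<And>k. 1 \<le> k \<Longrightarrow> k < length xs \<Longrightarrow> q k < k \<and> (xs ! q k, xs ! k) \<in> parcs T"
    and mono: "\<And>j k. 1 \<le> j \<Longrightarrow> j \<le> k \<Longrightarrow> k < length xs \<Longrightarrow> q j \<le> q k"
    and ne: "xs \<noteq> []" and dist: "distinct xs"
    using bfs_state_parents[OF xs(1)] by blast
  interpret pair_graph T using T by (simp add: undirected_tree_def)
  have acyc: "undirected_acyclic T" using T by (simp add: undirected_tree_def)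
  have sym: "sym (parcs T)" using sym_arcs unfolding symmetric_def by simp
  have noloop: "x \<noteq> y" if "(x, y) \<in> parcs T" for x y using that no_loops' by auto
  let ?n = "length xs"
  define F where "F = (\<lambda>k. (xs ! q k, xs ! k)) ` {1..<?n} \<union> (\<lambda>k. (xs ! k, xs ! q k)) ` {1..<?n}"
  have q_arc: "(xs ! q k, xs ! k) \<in> parcs T" "q k < ?n" if "k \<in> {1..<?n}" for k
    using q[of k] that by auto
  have FT: "F \<subseteq> parcs T" unfolding F_def using q_arc symD[OF sym] by blast
  have FV: "F \<subseteq> pverts T \<times> pverts T"
    unfolding F_def xs(2)[symmetric] using q_arc(2) by auto
  have root: "(xs ! 0, xs ! k) \<in> F\<^sup>*" if "k < ?n" for k
    using that
  proof (induction k rule: less_induct)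
    case (less k)
    show ?case
    proof (cases "k = 0")
      case False
      then have "q k < k" using q[of k] less.prems by simp
      then have "(xs ! 0, xs ! q k) \<in> F\<^sup>*" using less by simp
      moreover have "(xs ! q k, xs ! k) \<in> F" using False less.prems by (auto simp: F_def)
      ultimately show ?thesis by (rule rtrancl_into_rtrancl)
    qed simp
  qed
  have symF: "sym F" unfolding F_def sym_def by blast
  have conn: "(xs ! a, xs ! b) \<in> F\<^sup>*" if "a < ?n" "b < ?n" for a b
    using root[OF that(1)] root[OF that(2)] symD[OF sym_rtrancl[OF symF]] by (meson rtrancl_trans)
  have "parcs T \<subseteq> F"
  proof
    fix e assume e: "e \<in> parcs T"
    obtain x y where xy: "e = (x, y)" by force
    then have "x \<in> set xs" "y \<in> set xs" using e xs(2) in_arcsD1 in_arcsD2 by auto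
    then obtain a b where ab: "a < ?n" "b < ?n" "x = xs ! a" "y = xs ! b" by (metis in_set_conv_nth)
    show "e \<in> F"
      unfolding xy using e[unfolded xy] noloop \<open>y \<in> set xs\<close> xs(2) ab conn[of a b]
      by (intro undirected_acyclic_connected_arcs[OF acyc sym FT FV]) auto
  qed
  then have arcs: "parcs T = F" using FT by blast
  \<comment> \<open>List positions start at 0 and labels at 1, so both the argument and the value of
    \<open>q\<close> are shifted.\<close>
  define p where "p j = q (j - 1) + 1" for j
  define v where "v j = xs ! (j - 1)" for j
  have q': "q (j - 1) < j - 1" if "2 \<le> j" "j \<le> ?n" for j using q[of "j - 1"] that by auto
  have shift: "{1..<?n} = (\<lambda>j. j - 1) ` {2..?n}"
  proof safe
    fix k assume "k \<in> {1..<?n}"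
    then show "k \<in> (\<lambda>j. j - 1) ` {2..?n}" by (intro image_eqI[of _ _ "k + 1"]) auto
  qed auto
  have "labeled_tree ?n p T l v"
  proof unfold_locales
    show "1 \<le> ?n" using ne by (cases xs) auto
    show "1 \<le> p j" for j by (simp add: p_def)
    show "p j < j" if "2 \<le> j" "j \<le> ?n" for j using q'[OF that] by (simp add: p_def)
    show "p i \<le> p j" if "2 \<le> i" "i \<le> j" "j \<le> ?n" for i j
      using mono[of "i - 1" "j - 1"] that by (simp add: p_def)
    show "inj_on v {1..?n}"
      using dist by (auto simp: inj_on_def v_def nth_eq_iff_index_eq)
    show "pverts T = v ` {1..?n}"
    proof -
      have "x \<in> v ` {1..?n}" if x: "x \<in> set xs" for x
      proof -
        obtain k where "k < ?n" "x = xs ! k" using x by (metis in_set_conv_nth)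
        then show ?thesis by (intro image_eqI[of _ _ "k + 1"]) (auto simp: v_def)
      qed
      moreover have "v j \<in> set xs" if "j \<in> {1..?n}" for j using that by (auto simp: v_def)
      ultimately show ?thesis using xs(2) by blast
    qed
    show "l (v j) = j" if "j \<in> {1..?n}" for j
    proof -
      have "j - 1 < ?n" using that ne by auto
      then show ?thesis using xs(3)[of "j - 1"] that by (simp add: v_def)
    qed
    show "parcs T = (\<lambda>j. (v (p j), v j)) ` {2..?n} \<union> (\<lambda>j. (v j, v (p j))) ` {2..?n}"
      unfolding arcs F_def shift image_image by (simp add: v_def p_def)
  qed
  then show ?thesis by blast
qed

section \<open>Paths in terms of the parent function\<close>

lemma vwalk_arcs_in_set: "(x, y) \<in> set (vwalk_arcs w) \<Longrightarrow> x \<in> set w \<and> y \<in> set (tl w)"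
  by (induction w rule: vwalk_arcs.induct) auto

lemma vwalk_arcs_functional:
  assumes "distinct w"
  shows "(x, y) \<in> set (vwalk_arcs w) \<Longrightarrow> (x, z) \<in> set (vwalk_arcs w) \<Longrightarrow> y = z"
  using assms
proof (induction w rule: vwalk_arcs.induct)
  case (3 a b w)
  then have "x = a \<Longrightarrow> (x, c) \<notin> set (vwalk_arcs (b # w))" for c
    using vwalk_arcs_in_set[of x c "b # w"] by auto
  then show ?case using 3 by auto
qed auto

lemma vwalk_arcs_injective:
  assumes "distinct w"
  shows "(y, x) \<in> set (vwalk_arcs w) \<Longrightarrow> (z, x) \<in> set (vwalk_arcs w) \<Longrightarrow> y = z"
  using assms
proof (induction w rule: vwalk_arcs.induct)
  case (3 a b w)
  then have "x = b \<Longrightarrow> (c, x) \<notin> set (vwalk_arcs (b # w))" for c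
    using vwalk_arcs_in_set[of c x "b # w"] by auto
  then show ?case using 3 by auto
qed auto

text \<open>Along a list of distinct vertices each has at most one successor and one predecessor, so
  two of three neighbors coincide.\<close>

lemma path_graph_degree_le_2:
  assumes "path_graph T" "(x, a) \<in> parcs T" "(x, b) \<in> parcs T" "(x, c) \<in> parcs T"
  shows "a = b \<or> a = c \<or> b = c"
proof -
  obtain w where "distinct w" "parcs T = set (vwalk_arcs w) \<union> (set (vwalk_arcs w))\<inverse>"
    using assms(1) unfolding path_graph_def by blast
  then show ?thesis using assms(2-4) vwalk_arcs_functional[of w] vwalk_arcs_injective[of w]
    by (metis Un_iff converse_iff)
qed

lemma vwalk_arcs_map: "vwalk_arcs (map f w) = map (map_prod f f) (vwalk_arcs w)"
  by (induction w rule: vwalk_arcs.induct) auto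

lemma set_vwalk_arcs_upt: "set (vwalk_arcs [a..<b]) = (\<lambda>i. (i - 1, i)) ` {a + 1..<b}"
proof (induction b)
  case (Suc b)
  show ?case
  proof (cases "a < b")
    case True
    then have "{a + 1..<Suc b} = insert b {a + 1..<b}" by auto
    then show ?thesis using True Suc by (simp add: set_vwalk_arcs_snoc)
  next
    case False
    then show ?thesis by (cases "a = b") auto
  qed
qed simp

context labeled_tree
begin

lemma leaf_iff: "leaf T x \<longleftrightarrow> x \<in> pverts T \<and> (\<forall>y z. (x, y) \<in> parcs T \<and> (x, z) \<in> parcs T \<longrightarrow> y = z)"
proof -
  have "out_arcs (with_proj T) x = Pair x ` {y. (x, y) \<in> parcs T}"
    by (auto simp: out_arcs_def)
  then have "out_degree (with_proj T) x = card {y. (x, y) \<in> parcs T}"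
    by (simp add: out_degree_def card_image inj_on_def)
  moreover have "finite (snd ` parcs T)" by (simp add: arcs_eq)
  then have "finite {y. (x, y) \<in> parcs T}" by (rule finite_subset[rotated]) force
  ultimately show ?thesis unfolding leaf_def by (auto simp: card_le_Suc0_iff_eq)
qed

lemma p_in: "j \<in> {2..n} \<Longrightarrow> p j \<in> {1..n}"
  using p_pos[of j] p_less[of j] by auto

lemma v_eq_iff: "i \<in> {1..n} \<Longrightarrow> j \<in> {1..n} \<Longrightarrow> v i = v j \<longleftrightarrow> i = j"
  using inj_v by (auto dest: inj_onD)

lemma arc_parent: "j \<in> {2..n} \<Longrightarrow> (v j, v (p j)) \<in> parcs T"
  and arc_child: "j \<in> {2..n} \<Longrightarrow> (v (p j), v j) \<in> parcs T"
  by (auto simp: arcs_eq)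

lemma arc_iff:
  assumes "i \<in> {1..n}" "j \<in> {1..n}"
  shows "(v i, v j) \<in> parcs T \<longleftrightarrow> (2 \<le> j \<and> i = p j) \<or> (2 \<le> i \<and> j = p i)"
proof
  assume "(v i, v j) \<in> parcs T"
  then obtain k where k: "k \<in> {2..n}" "v i = v (p k) \<and> v j = v k \<or> v i = v k \<and> v j = v (p k)"
    unfolding arcs_eq by blast
  moreover have "k \<in> {1..n}" using k(1) by simp
  ultimately have "i = p k \<and> j = k \<or> i = k \<and> j = p k"
    using assms p_in[OF k(1)] by (simp add: v_eq_iff)
  then show "2 \<le> j \<and> i = p j \<or> 2 \<le> i \<and> j = p i" using k(1) by auto
next
  assume "2 \<le> j \<and> i = p j \<or> 2 \<le> i \<and> j = p i"
  then show "(v i, v j) \<in> parcs T" using assms arc_child[of j] arc_parent[of i] by auto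
qed

lemma card_verts: "card (pverts (relabel l T)) = n"
  and relabel_arcs: "{hankel_minor i j | i j. i < j \<and> (i, j) \<in> parcs (relabel l T)} = (minors :: 'k::field mpoly set)"
proof -
  have "l ` pverts T = {1..n}" unfolding verts_eq image_image using label_v by simp
  then show "card (pverts (relabel l T)) = n" by (simp add: relabel_def)
  have "parcs (relabel l T) = (\<lambda>j. (p j, j)) ` {2..n} \<union> (\<lambda>j. (j, p j)) ` {2..n}"
    unfolding relabel_def arcs_eq using p_in by (auto simp: image_Un image_image label_v image_iff)
  then have "i < j \<and> (i, j) \<in> parcs (relabel l T) \<longleftrightarrow> j \<in> {2..n} \<and> i = p j" for i j
    using p_less by fastforce
  then show "{hankel_minor i j | i j. i < j \<and> (i, j) \<in> parcs (relabel l T)} = (minors :: 'k mpoly set)"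
    unfolding minors_def by auto
qed

lemma complete_intersection_iff:
  "complete_intersection (hankel_ring (relabel l T) :: 'k::field mpoly ring) (hankel_edge_ideal (relabel l T))
     \<longleftrightarrow> ci_pattern"
  using complete_intersection_iff_ci_pattern[where 'k = 'k]
  by (simp only: hankel_ring_def hankel_edge_ideal_def card_verts relabel_arcs)

text \<open>The hypotheses say that the root has at most two children and every other vertex at most
  one, and they exclude the path 4, 2, 1, 3, 5, whose root is two steps away from both ends. Once
  \<open>p j = j - 1\<close> for some \<open>j \<ge> 3\<close>, monotonicity and the second
  hypothesis propagate this equation to all later vertices.\<close>

lemma ci_patternI:
  assumes a: "4 \<le> n \<Longrightarrow> p 4 \<noteq> 1"
    and b: "\<And>j. 2 \<le> j \<Longrightarrow> j + 1 \<le> n \<Longrightarrow> 2 \<le> p j \<Longrightarrow> p (j + 1) \<noteq> p j"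
    and c: "5 \<le> n \<Longrightarrow> p 3 = 1 \<Longrightarrow> p 4 = 2 \<Longrightarrow> p 5 \<noteq> 3"
  shows ci_pattern
proof -
  have next_parent: "p (j + 1) = j" if "3 \<le> j" "j + 1 \<le> n" "p j = j - 1" for j
  proof -
    have "p (j + 1) \<noteq> p j" using that by (intro b) auto
    moreover have "p j \<le> p (j + 1)" "p (j + 1) < j + 1" using that p_mono[of j "j + 1"] p_less[of "j + 1"] by auto
    ultimately show ?thesis using that by linarith
  qed
  have from_start: "p j = j - 1" if "i \<le> j" "j \<le> n" "3 \<le> i" "p i = i - 1" for i j
    using that
  proof (induction rule: dec_induct)
    case (step k)
    then show ?case using next_parent[of k] by auto
  qed simp
  show ?thesis
  proof (cases "3 \<le> n")
    case True
    then have "p 3 = 1 \<or> p 3 = 2" using p_pos[of 3] p_less[of 3] by auto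
    then show ?thesis
    proof
      assume "p 3 = 2"
      then show ?thesis using from_start[of 3] by (auto simp: ci_pattern_def)
    next
      assume p3: "p 3 = 1"
      have p4: "p 4 = 2 \<or> p 4 = 3" if "4 \<le> n" using a[OF that] p_pos[of 4] p_less[of 4] that by auto
      have "p j = j - 1" if j: "5 \<le> j" "j \<le> n" for j
      proof -
        \<comment> \<open>If \<open>p 4 = 2\<close>, then 5 may hang on 2, 3 or 4; the second
          hypothesis excludes 2 and the third excludes 3.\<close>
        have "p 4 = 3 \<or> p 5 = 4"
          using p4 c p3 b[of 4] p_mono[of 4 5] p_less[of 5] j by (auto simp: numeral_eq_Suc le_Suc_eq less_Suc_eq)
        then show ?thesis using from_start[of 4 j] from_start[of 5 j] j by auto
      qed
      then show ?thesis using True p3 p4 by (auto simp: ci_pattern_def)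
    qed
  qed (auto simp: ci_pattern_def)
qed

lemma path_imp_ci_pattern:
  assumes path: "path_graph T"
    and r: "leaf T (v 1) \<or> (\<exists>u. leaf T u \<and> (v 1, u) \<in> parcs T)"
  shows ci_pattern
proof (rule ci_patternI)
  have deg: "i = j \<or> i = k \<or> j = k"
    if "{i, j, k} \<subseteq> {1..n}" "(v x, v i) \<in> parcs T" "(v x, v j) \<in> parcs T" "(v x, v k) \<in> parcs T" for x i j k
    using path_graph_degree_le_2[OF path that(2-4)] that(1) by (auto simp: v_eq_iff)
  show "p 4 \<noteq> 1" if "4 \<le> n"
  proof
    assume "p 4 = 1"
    then have "p 2 = 1" "p 3 = 1" using p_2 p_mono[of 3 4] p_pos[of 3] that by auto
    then show False
      using deg[of 2 3 4 1] arc_child[of 2] arc_child[of 3] arc_child[of 4] \<open>p 4 = 1\<close> that by auto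
  qed
  show "p (j + 1) \<noteq> p j" if j: "2 \<le> j" "j + 1 \<le> n" "2 \<le> p j" for j
  proof
    assume eq: "p (j + 1) = p j"
    let ?i = "p j"
    have lt: "?i < j" "p ?i < ?i" "1 \<le> p ?i" using p_less[of j] p_less[of ?i] p_pos[of ?i] j by auto
    have "(v ?i, v j) \<in> parcs T" "(v ?i, v (p ?i)) \<in> parcs T" "(v ?i, v (j + 1)) \<in> parcs T"
      using arc_child[of j] arc_child[of "j + 1"] arc_parent[of ?i] lt j eq by auto
    then show False using deg[of j "p ?i" "j + 1" ?i] lt j by auto
  qed
  \<comment> \<open>Otherwise 1, 2 and 3 have two neighbors each. As 2 and 3 are the only neighbors
    of the root, the root would be neither a leaf nor adjacent to one.\<close>
  show "p 5 \<noteq> 3" if n: "5 \<le> n" and p3: "p 3 = 1" and p4: "p 4 = 2"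
  proof
    assume p5: "p 5 = 3"
    have p2: "p 2 = 1" using p_2 n by simp
    have arcs: "(v 1, v 2) \<in> parcs T" "(v 1, v 3) \<in> parcs T" "(v 2, v 1) \<in> parcs T"
      "(v 2, v 4) \<in> parcs T" "(v 3, v 1) \<in> parcs T" "(v 3, v 5) \<in> parcs T"
      using arc_child[of 2] arc_child[of 3] arc_parent[of 2] arc_child[of 4] arc_parent[of 3] arc_child[of 5]
        p2 p3 p4 p5 n by auto
    have "v 2 \<noteq> v 3" "v 1 \<noteq> v 4" "v 1 \<noteq> v 5" using n by (simp_all add: v_eq_iff)
    then have nl: "\<not> leaf T (v 1)" "\<not> leaf T (v 2)" "\<not> leaf T (v 3)"
      using arcs unfolding leaf_iff by blast+
    then obtain u where u: "leaf T u" "(v 1, u) \<in> parcs T" using r by blast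
    then obtain j where j: "j \<in> {1..n}" "u = v j" using verts_eq unfolding leaf_def by blast
    then have "2 \<le> j \<and> p j = 1" using u(2) arc_iff[of 1 j] n by auto
    moreover have "\<not> 4 \<le> j" using p_mono[of 4 j] p4 j calculation by auto
    ultimately have "j = 2 \<or> j = 3" by auto
    then show False using u j nl by auto
  qed
qed

lemma path_graphI:
  assumes "distinct w" "set w = {1..n}"
    and "set (vwalk_arcs w) \<union> (set (vwalk_arcs w))\<inverse> =
      (\<lambda>j. (p j, j)) ` {2..n} \<union> ((\<lambda>j. (p j, j)) ` {2..n})\<inverse>"
  shows "path_graph T"
  unfolding path_graph_def
proof (intro exI[of _ "map v w"] conjI)
  show "map v w \<noteq> []" using assms(2) n_pos by auto
  show "distinct (map v w)" using assms(1,2) inj_v by (simp add: distinct_map)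
  show "pverts T = set (map v w)" using assms(2) verts_eq by simp
  let ?A = "set (vwalk_arcs w)" and ?B = "(\<lambda>j. (p j, j)) ` {2..n}"
  have conv: "map_prod v v ` (A\<inverse>) = (map_prod v v ` A)\<inverse>" for A by force
  have "set (vwalk_arcs (map v w)) \<union> (set (vwalk_arcs (map v w)))\<inverse> = map_prod v v ` (?A \<union> ?A\<inverse>)"
    by (simp add: vwalk_arcs_map image_Un conv)
  also have "\<dots> = map_prod v v ` (?B \<union> ?B\<inverse>)" using assms(3) by simp
  also have "\<dots> = map_prod v v ` ?B \<union> (map_prod v v ` ?B)\<inverse>" by (simp only: image_Un conv)
  also have "\<dots> = parcs T" unfolding arcs_eq image_image by force
  finally show "parcs T = set (vwalk_arcs (map v w)) \<union> (set (vwalk_arcs (map v w)))\<inverse>" ..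
qed

text \<open>The root may have one child, named \<open>c\<close>; any other vertex already has its
  parent as a neighbor and must be childless.\<close>

lemma leafI:
  assumes "i \<in> {1..n}" "\<And>j. j \<in> {2..n} \<Longrightarrow> p j = i \<Longrightarrow> j = c" "2 \<le> i \<Longrightarrow> \<not> (\<exists>j\<in>{2..n}. p j = i)"
  shows "leaf T (v i)"
  unfolding leaf_iff
proof (intro conjI allI impI; (elim conjE)?)
  show "v i \<in> pverts T" using assms(1) verts_eq by blast
  fix y z assume yz: "(v i, y) \<in> parcs T" "(v i, z) \<in> parcs T"
  have "\<exists>j\<in>{1..n}. x = v j" if "(v i, x) \<in> parcs T" for x
    using that p_in by (fastforce simp: arcs_eq)
  then obtain j k where jk: "j \<in> {1..n}" "y = v j" "k \<in> {1..n}" "z = v k" using yz by metis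
  then have "2 \<le> j \<and> i = p j \<or> 2 \<le> i \<and> j = p i" "2 \<le> k \<and> i = p k \<or> 2 \<le> i \<and> k = p i"
    using yz arc_iff assms(1) by auto
  then have "j = k" using assms(2,3) jk(1,3) by (metis atLeastAtMost_iff)
  then show "y = z" using jk by simp
qed

lemma ci_pattern_imp_path:
  assumes ci_pattern
  shows "path_graph T \<and> (leaf T (v 1) \<or> (\<exists>u. leaf T u \<and> (v 1, u) \<in> parcs T))"
  using assms[unfolded ci_pattern_def]
proof
  assume p: "\<forall>j\<in>{3..n}. p j = j - 1"
  have p': "p j = j - 1" if "j \<in> {2..n}" for j
    using p p_2 that by (cases "j = 2") auto
  have "set (vwalk_arcs [1..<n + 1]) = (\<lambda>j. (p j, j)) ` {2..n}"
    unfolding set_vwalk_arcs_upt using p' by (intro image_cong) auto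
  then have "path_graph T" by (intro path_graphI[of "[1..<n + 1]"]) auto
  moreover have "leaf T (v 1)"
    using n_pos p' by (intro leafI[of 1 2]) auto
  ultimately show ?thesis by blast
next
  assume "3 \<le> n \<and> p 3 = 1 \<and> (4 \<le> n \<longrightarrow> p 4 \<in> {2, 3}) \<and> (\<forall>j\<in>{5..n}. p j = j - 1)"
  then have n: "3 \<le> n" and p3: "p 3 = 1" and p4: "4 \<le> n \<Longrightarrow> p 4 = 2 \<or> p 4 = 3"
    and p5: "\<And>j. 5 \<le> j \<Longrightarrow> j \<le> n \<Longrightarrow> p j = j - 1" by auto
  have p2: "p 2 = 1" using p_2 n by simp
  have cs: "j = 2 \<or> j = 3 \<or> j = 4 \<or> 5 \<le> j" if "2 \<le> j" for j :: nat using that by auto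
  consider "p 4 = 3 \<or> n = 3" | "4 \<le> n" "p 4 = 2" using p4 n by fastforce
  then show ?thesis
  proof cases
    case 1
    \<comment> \<open>The path is read from the leaf 2 through the root. Its arcs differ from the
      parent arcs only in the direction of the first edge, which disappears in the symmetric
      closure.\<close>
    let ?w = "2 # 1 # [3..<n + 1]"
    have p4': "p j = j - 1" if "4 \<le> j" "j \<le> n" for j
      using 1 p5[of j] that by (cases "j = 4") auto
    have "[3..<n + 1] \<noteq> []" using n by simp
    moreover have "hd [3..<n + 1] = 3" using n by (subst upt_conv_Cons) auto
    ultimately have "set (vwalk_arcs ?w) = {(2, 1), (1, 3)} \<union> (\<lambda>j. (j - 1, j)) ` {4..<n + 1}"
      using set_vwalk_arcs_upt[of 3 "n + 1"] by simp
    also have "(\<lambda>j. (j - 1, j)) ` {4..<n + 1} = (\<lambda>j. (p j, j)) ` {4..n}"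
      using p4' by (intro image_cong) auto
    finally have w: "set (vwalk_arcs ?w) = {(2, 1), (1, 3)} \<union> (\<lambda>j. (p j, j)) ` {4..n}" .
    have "{2..n} = {2, 3} \<union> {4..n}" using n by auto
    then have B: "(\<lambda>j. (p j, j)) ` {2..n} = {(1, 2), (1, 3)} \<union> (\<lambda>j. (p j, j)) ` {4..n}"
      using p2 p3 by auto
    have "path_graph T"
    proof (rule path_graphI[of ?w])
      show "set ?w = {1..n}" using n by auto
      show "set (vwalk_arcs ?w) \<union> (set (vwalk_arcs ?w))\<inverse> =
        (\<lambda>j. (p j, j)) ` {2..n} \<union> ((\<lambda>j. (p j, j)) ` {2..n})\<inverse>"
        unfolding w B converse_Un by auto
    qed simp
    moreover have "leaf T (v 2)"
    proof (rule leafI)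
      have "p j \<noteq> 2" if j: "j \<in> {2..n}" for j
        using cs[of j] p2 p3 1 p5[of j] j by auto
      \<comment> \<open>Vertex 2 has no child, so the value 0 for \<open>c\<close> is
        arbitrary.\<close>
      then show "\<not> (\<exists>j\<in>{2..n}. p j = 2)" "\<And>j. j \<in> {2..n} \<Longrightarrow> p j = 2 \<Longrightarrow> j = 0" by blast+
    qed (use n in auto)
    moreover have "(v 1, v 2) \<in> parcs T" using arc_child[of 2] p2 n by auto
    ultimately show ?thesis by blast
  next
    case 2
    \<comment> \<open>Now 3 is the leaf next to the root, and the path continues on the other side
      through 2 to 4. Again only the first edge is reversed.\<close>
    let ?w = "3 # 1 # 2 # [4..<n + 1]"
    have "[4..<n + 1] \<noteq> []" using 2 by simp
    moreover have "hd [4..<n + 1] = 4" using 2 by (subst upt_conv_Cons) auto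
    ultimately have "set (vwalk_arcs ?w) = {(3, 1), (1, 2), (2, 4)} \<union> (\<lambda>j. (j - 1, j)) ` {5..<n + 1}"
      using set_vwalk_arcs_upt[of 4 "n + 1"] by simp
    also have "(\<lambda>j. (j - 1, j)) ` {5..<n + 1} = (\<lambda>j. (p j, j)) ` {5..n}"
      using p5 by (intro image_cong) auto
    finally have w: "set (vwalk_arcs ?w) = {(3, 1), (1, 2), (2, 4)} \<union> (\<lambda>j. (p j, j)) ` {5..n}" .
    have "{2..n} = {2, 3, 4} \<union> {5..n}" using 2 by auto
    then have B: "(\<lambda>j. (p j, j)) ` {2..n} = {(1, 2), (1, 3), (2, 4)} \<union> (\<lambda>j. (p j, j)) ` {5..n}"
      using p2 p3 2 by auto
    have "path_graph T"
    proof (rule path_graphI[of ?w])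
      show "set ?w = {1..n}" using 2 by auto
      show "set (vwalk_arcs ?w) \<union> (set (vwalk_arcs ?w))\<inverse> =
        (\<lambda>j. (p j, j)) ` {2..n} \<union> ((\<lambda>j. (p j, j)) ` {2..n})\<inverse>"
        unfolding w B converse_Un by auto
    qed simp
    moreover have "leaf T (v 3)"
    proof (rule leafI)
      have "p j \<noteq> 3" if j: "j \<in> {2..n}" for j
        using cs[of j] p2 p3 2 p5[of j] j by auto
      then show "\<not> (\<exists>j\<in>{2..n}. p j = 3)" "\<And>j. j \<in> {2..n} \<Longrightarrow> p j = 3 \<Longrightarrow> j = 0" by blast+
    qed (use n in auto)
    moreover have "(v 1, v 3) \<in> parcs T" using arc_child[of 3] p3 n by auto
    ultimately show ?thesis by blast
  qed
qed

lemma root_iff: "r \<in> pverts T \<and> l r = 1 \<longleftrightarrow> r = v 1"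
  using verts_eq label_v n_pos by auto

end

theorem corollary3p3:
  fixes T :: "'v pair_pre_digraph" and l :: "'v \<Rightarrow> nat"
  assumes "undirected_tree T" and "rooted_labeling T l"
  shows "complete_intersection (hankel_ring (relabel l T) :: 'k::field mpoly ring)
           (hankel_edge_ideal (relabel l T))
         \<longleftrightarrow> path_graph T \<and>
           (\<exists>r \<in> pverts T. l r = 1 \<and> (leaf T r \<or> (\<exists>u. leaf T u \<and> (r, u) \<in> parcs T)))"
proof -
  obtain n p v where "labeled_tree n p T l v"
    using labeled_tree_exists[OF assms] by blast
  then interpret labeled_tree n p T l v .
  have "(\<exists>r \<in> pverts T. l r = 1 \<and> (leaf T r \<or> (\<exists>u. leaf T u \<and> (r, u) \<in> parcs T)))
      \<longleftrightarrow> leaf T (v 1) \<or> (\<exists>u. leaf T u \<and> (v 1, u) \<in> parcs T)"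
    by (metis root_iff)
  then show ?thesis
    using complete_intersection_iff[where 'k = 'k] ci_pattern_imp_path path_imp_ci_pattern by blast
qed

end
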